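(* Fix a modulus $k$ and constants $\alpha_0,\beta_0,\phi\in\mathbb{C}$ (generic), and set $\alpha_n=\alpha_0+n\phi$, $\beta_m=\beta_0-m\phi$ for $n,m\in\mathbb{Z}$. Consider the lattice system $$Q_{\alpha_n,\beta_m}(v_{n,m},v_{n+1,m},v_{n,m+1},v_{n+1,m+1})=0,\qquad n,m\in\mathbb{Z},$$ where $$Q_{a,b}(w,x,y,z)=\mathrm{sn}(a)(wx+yz)-\mathrm{sn}(b)(wy+xz)-\mathrm{sn}(a-b)\big[xy+wz-k\,\mathrm{sn}(a)\mathrm{sn}(b)(1+wxyz)\big],$$ subject to the constraint $$v_{n,n+1}=v_{n+1,n},\qquad v_{n,n}=v_{n-1,n+1},\qquad n\in\mathbb{Z}.$$ This defines a system with two degrees of freedom (suitable initial data being the two values $v_{0,0}$ and $v_{0,1}$), and on the subset of variables $v_{n,n},v_{n,n+1}$, $n\in\mathbb{Z}$, it coincides with the difference equation $$\begin{aligned}&\mathrm{cn}(\gamma_n)\mathrm{dn}(\gamma_n)\big(1-k^2\mathrm{sn}^4(z_n)\big)u_n(u_{n+1}+u_{n-1})\\&-\mathrm{cn}(z_n)\mathrm{dn}(z_n)\big(1-k^2\mathrm{sn}^2(z_n)\mathrm{sn}^2(\gamma_n)\big)(u_{n+1}u_{n-1}+u_n^2)\\&+\big(\mathrm{cn}^2(z_n)-\mathrm{cn}^2(\gamma_n)\big)\mathrm{cn}(z_n)\mathrm{dn}(z_n)\big(1+k^2u_n^2u_{n+1}u_{n-1}\big)=0,\qquad n\in\mathbb{Z},\end{aligned}$$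 with $z_n=(\gamma_e+\gamma_o)n+z_0$, $\gamma_n=\gamma_e$ for even $n$ and $\gamma_n=\gamma_o$ for odd $n$, modulo the identifications $$(u_{2n-1},u_{2n})=\left(\frac{v_{n,n}}{\sqrt{k}},\frac{v_{n,n+1}}{\sqrt{k}}\right),\quad n\in\mathbb{Z},$$ $$z_0=\frac{\alpha_0-\beta_0}{2},\qquad \gamma_e=\frac{\alpha_0+\beta_0}{2},\qquad \gamma_o=\frac{\phi-\alpha_0-\beta_0}{2}.$$
   Context: $\mathrm{sn},\mathrm{cn},\mathrm{dn}$ are the Jacobi elliptic functions of modulus $k$. The lattice system is the quad-equation Q4 in Jacobi form on $\mathbb{Z}^2$. "Two degrees of freedom" means that generic values of $v_{0,0}$ and $v_{0,1}$ may be prescribed freely and then determine, through the lattice equation and the constraint, all $v_{n,m}$. *)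

theory Defs
  imports "HOL-Complex_Analysis.Complex_Analysis" "HOL-Computational_Algebra.Polynomial"
begin

(* sn, cn, dn of modulus k: the meromorphic solution on the whole plane of the defining
   initial value problem.  These conditions determine the three functions uniquely; the value
   at a pole is 0 by the convention of nicely_meromorphic_on.  Since cn^2 = 1 - sn^2 and
   dn^2 = 1 - k^2 sn^2, the three functions have the same poles. *)
definition jacobi_elliptic ::
  "complex \<Rightarrow> (complex \<Rightarrow> complex) \<Rightarrow> (complex \<Rightarrow> complex) \<Rightarrow> (complex \<Rightarrow> complex) \<Rightarrow> bool" where
  "jacobi_elliptic k sn cn dn \<longleftrightarrow>
     sn nicely_meromorphic_on UNIV \<and> cn nicely_meromorphic_on UNIV \<and> dn nicely_meromorphic_on UNIV \<and>
     \<not> is_pole sn 0 \<and> sn 0 = 0 \<and> cn 0 = 1 \<and> dn 0 = 1 \<and>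
     (\<forall>z. \<not> is_pole sn z \<longrightarrow>
        (sn has_field_derivative cn z * dn z) (at z) \<and>
        (cn has_field_derivative - (sn z * dn z)) (at z) \<and>
        (dn has_field_derivative - (k\<^sup>2 * sn z * cn z)) (at z))"

definition Q4 :: "complex \<Rightarrow> (complex \<Rightarrow> complex) \<Rightarrow> complex \<Rightarrow> complex \<Rightarrow>
    complex \<Rightarrow> complex \<Rightarrow> complex \<Rightarrow> complex \<Rightarrow> complex" where
  "Q4 k sn a b w x y z =
     sn a * (w * x + y * z) - sn b * (w * y + x * z)
     - sn (a - b) * (x * y + w * z - k * sn a * sn b * (1 + w * x * y * z))"

definition Q4_at :: "complex \<Rightarrow> (complex \<Rightarrow> complex) \<Rightarrow> complex \<Rightarrow> complex \<Rightarrow> complex \<Rightarrow>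
    (int \<Rightarrow> int \<Rightarrow> complex) \<Rightarrow> int \<Rightarrow> int \<Rightarrow> bool" where
  "Q4_at k sn \<alpha>\<^sub>0 \<beta>\<^sub>0 \<phi> v n m \<longleftrightarrow>
     Q4 k sn (\<alpha>\<^sub>0 + of_int n * \<phi>) (\<beta>\<^sub>0 - of_int m * \<phi>)
       (v n m) (v (n + 1) m) (v n (m + 1)) (v (n + 1) (m + 1)) = 0"

definition diagonal_constraint :: "(int \<Rightarrow> int \<Rightarrow> complex) \<Rightarrow> bool" where
  "diagonal_constraint v \<longleftrightarrow> (\<forall>n. v n (n + 1) = v (n + 1) n \<and> v n n = v (n - 1) (n + 1))"

definition constrained_Q4_system :: "complex \<Rightarrow> (complex \<Rightarrow> complex) \<Rightarrow> complex \<Rightarrow> complex \<Rightarrow> complex \<Rightarrow>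
    (int \<Rightarrow> int \<Rightarrow> complex) \<Rightarrow> bool" where
  "constrained_Q4_system k sn \<alpha>\<^sub>0 \<beta>\<^sub>0 \<phi> v \<longleftrightarrow>
     (\<forall>n m. Q4_at k sn \<alpha>\<^sub>0 \<beta>\<^sub>0 \<phi> v n m) \<and> diagonal_constraint v"

definition elliptic_difference_equation ::
  "complex \<Rightarrow> (complex \<Rightarrow> complex) \<Rightarrow> (complex \<Rightarrow> complex) \<Rightarrow> (complex \<Rightarrow> complex) \<Rightarrow>
   complex \<Rightarrow> complex \<Rightarrow> complex \<Rightarrow> (int \<Rightarrow> complex) \<Rightarrow> bool" where
  "elliptic_difference_equation k sn cn dn z\<^sub>0 \<gamma>\<^sub>e \<gamma>\<^sub>o u \<longleftrightarrow>
     (\<forall>n. let z = (\<gamma>\<^sub>e + \<gamma>\<^sub>o) * of_int n + z\<^sub>0; \<gamma> = (if even n then \<gamma>\<^sub>e else \<gamma>\<^sub>o) in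
        cn \<gamma> * dn \<gamma> * (1 - k ^ 2 * sn z ^ 4) * u n * (u (n + 1) + u (n - 1))
        - cn z * dn z * (1 - k ^ 2 * sn z ^ 2 * sn \<gamma> ^ 2) * (u (n + 1) * u (n - 1) + u n ^ 2)
        + (cn z ^ 2 - cn \<gamma> ^ 2) * cn z * dn z * (1 + k ^ 2 * u n ^ 2 * u (n + 1) * u (n - 1)) = 0)"

(* r plays the role of the square root of k. *)
definition identified :: "complex \<Rightarrow> (int \<Rightarrow> int \<Rightarrow> complex) \<Rightarrow> (int \<Rightarrow> complex) \<Rightarrow> bool" where
  "identified r v u \<longleftrightarrow> (\<forall>n. u (2 * n - 1) = v n n / r \<and> u (2 * n) = v n (n + 1) / r)"

(* Generic initial data: the exceptional pairs lie in a countable union of proper algebraic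
   curves (countably many, since every lattice site contributes a denominator).  An element of
   complex poly poly is a polynomial in two variables, the outer one being evaluated at y. *)
definition generic_pair :: "(complex \<Rightarrow> complex \<Rightarrow> bool) \<Rightarrow> bool" where
  "generic_pair P \<longleftrightarrow>
     (\<exists>F :: nat \<Rightarrow> complex poly poly. (\<forall>i. F i \<noteq> 0) \<and>
        (\<forall>x y. (\<forall>i. poly (poly (F i) [:y:]) x \<noteq> 0) \<longrightarrow> P x y))"

(* Generic parameters, which enter through transcendental functions: the exceptional triples lie
   in a countable union of zero sets of entire functions on C^3 that do not vanish identically.
   Entire is expressed as holomorphic in each variable separately (Hartogs). *)
definition generic_triple :: "(complex \<Rightarrow> complex \<Rightarrow> complex \<Rightarrow> bool) \<Rightarrow> bool" where
  "generic_triple P \<longleftrightarrow>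
     (\<exists>F :: nat \<Rightarrow> complex \<Rightarrow> complex \<Rightarrow> complex \<Rightarrow> complex.
        (\<forall>i. (\<forall>b c. (\<lambda>a. F i a b c) holomorphic_on UNIV) \<and>
             (\<forall>a c. (\<lambda>b. F i a b c) holomorphic_on UNIV) \<and>
             (\<forall>a b. (\<lambda>c. F i a b c) holomorphic_on UNIV) \<and>
             (\<exists>a b c. F i a b c \<noteq> 0)) \<and>
        (\<forall>a b c. (\<forall>i. F i a b c \<noteq> 0) \<longrightarrow> P a b c))"

end

(* On the quads (n,n) and (n,n+1) the constraint makes two of the four corner values equal, and the
   addition theorem for sn turns the quad equation into the difference equation, up to the factor
   2 k sn(z) over the denominators of the addition theorem. All other quads determine one new value
   from known ones, moving away from the diagonals, so no consistency condition arises; only the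
   denominators of the solutions must be nonzero. Each denominator is a rational function of the
   initial values whose coefficients are meromorphic in the parameters, so it suffices to find one
   point at which it is defined and nonzero. At alpha_0 = beta_0 = K, phi = 0, where K is a zero of
   sn' (one exists by Picard's theorem), the solution is v(n,m) = r u(n+m-1) with
   u(n+1) u(n-1) = (s - u(n)^2) / (1 - s k^2 u(n)^2), s = sn(K)^2. If both initial values of u are
   equal to a small t, then each u(j) tends to 0 or infinity as t tends to 0, and u(j), u(j+2) have
   opposite limits, so that all denominators are nonzero for small t. *)
theory Submission
  imports Defs
begin

section \<open>Jacobi elliptic functions\<close>

text \<open>The functions are given only by their differential equations: neither periods nor the
  position of the poles are at hand. What replaces them is that the poles are countable, so that
  their complement is connected and a function with vanishing derivative there is constant.
  Genericity asks for entire functions of the parameters, while the denominators are only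
  meromorphic in them; hence each is carried as a global quotient of functions that are entire in
  the parameters and polynomial in the initial values. The reference point achieves two
  simplifications at once: \<open>sn' K = 0\<close> removes the first coefficient of the difference
  equation, and \<open>sn (\<alpha>\<^sub>n - \<beta>\<^sub>m) = 0\<close> lets each quad off the
  diagonals merely copy a value. But all \<open>z\<^sub>n\<close> are 0 there, and the factor
  \<open>sn z\<close> relating the two equations vanishes. The point therefore only shows that
  certain functions are not identically zero; the conditions for the equivalence are proved generic
  separately. Each denominator may use its own \<open>t\<close>, so no \<open>t\<close> has to work
  for all of them.\<close>

lemma connected_complement_countable_complex:
  fixes S :: "complex set"
  assumes "countable (- S)" shows "connected S"
proof -
  have "path_connected (- (- S))"
    by (rule path_connected_complement_countable[OF _ assms]) (simp only: DIM_complex order_refl)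
  then have "path_connected S" unfolding double_complement .
  then show ?thesis by (rule path_connected_imp_connected)
qed

text \<open>Source of the quadratic identities and of the addition theorem: differentiate, then
  compare with a point where the value is known.\<close>

lemma zero_derivative_const_complement_countable:
  fixes f :: "complex \<Rightarrow> complex"
  assumes "open S" "countable (- S)"
    and "\<And>z. z \<in> S \<Longrightarrow> (f has_field_derivative 0) (at z)"
    and "x \<in> S" "y \<in> S"
  shows "f x = f y"
proof -
  have "connected S"
    by (rule connected_complement_countable_complex) fact
  moreover have "continuous_on S f"
    by (rule DERIV_continuous_on[where D = "\<lambda>_. 0"])
       (rule has_field_derivative_at_within[OF assms(3)])
  ultimately obtain c where "\<And>z. z \<in> S \<Longrightarrow> f z = c"
    using DERIV_zero_connected_constant[of S "{}" f] assms(1,3) by (metis Diff_empty finite.emptyI)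
  then show ?thesis using assms(4,5) by simp
qed

text \<open>An open plane set is a countable union of compact sets, which supplies the
  \<open>fsigma\<close> hypothesis of the library fact.\<close>

lemma countable_zeros_complement_countable:
  fixes f :: "complex \<Rightarrow> complex"
  assumes "open S" "countable (- S)" "f holomorphic_on S" "\<not> f constant_on S"
  shows "countable {z \<in> S. f z = 0}"
proof -
  obtain C :: "nat \<Rightarrow> complex set" where "\<And>n. compact (C n)" "S = \<Union> (range C)"
    using open_Union_compact_subsets[OF assms(1)] by metis
  then have "range C \<subseteq> Collect compact" by auto
  then have "fsigma S"
    unfolding fsigma_Union_compact using \<open>S = \<Union> (range C)\<close> by (intro exI conjI)
  then show ?thesis
    by (rule holomorphic_countable_zeros[OF assms(3,1) connected_complement_countable_complex[OF assms(2)] _ assms(4)])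
qed

section \<open>The regular set and the quadratic identities\<close>

locale jacobi =
  fixes k :: complex and sn cn dn :: "complex \<Rightarrow> complex"
  assumes jacobi: "jacobi_elliptic k sn cn dn"
begin

definition reg :: "complex set" where "reg = {z. \<not> is_pole sn z}"

lemma zero_reg [simp]: "0 \<in> reg"
  and sn_0 [simp]: "sn 0 = 0" and cn_0 [simp]: "cn 0 = 1" and dn_0 [simp]: "dn 0 = 1"
  using jacobi by (auto simp: jacobi_elliptic_def reg_def)

lemma nicely_meromorphic:
  "sn nicely_meromorphic_on UNIV" "cn nicely_meromorphic_on UNIV" "dn nicely_meromorphic_on UNIV"
  using jacobi by (auto simp: jacobi_elliptic_def)

lemma derivs:
  assumes "z \<in> reg"
  shows "(sn has_field_derivative cn z * dn z) (at z)"
    and "(cn has_field_derivative - (sn z * dn z)) (at z)"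
    and "(dn has_field_derivative - (k\<^sup>2 * sn z * cn z)) (at z)"
  using jacobi assms by (auto simp: jacobi_elliptic_def reg_def)

lemma derivs_comp:
  assumes "g x \<in> reg" "(g has_field_derivative g') (at x)"
  shows "((\<lambda>x. sn (g x)) has_field_derivative cn (g x) * dn (g x) * g') (at x)"
    and "((\<lambda>x. cn (g x)) has_field_derivative - (sn (g x) * dn (g x)) * g') (at x)"
    and "((\<lambda>x. dn (g x)) has_field_derivative - (k\<^sup>2 * sn (g x) * cn (g x)) * g') (at x)"
  using DERIV_chain2[OF derivs(1)] DERIV_chain2[OF derivs(2)] DERIV_chain2[OF derivs(3)] assms by auto

lemma not_reg_sparse: "- reg sparse_in UNIV"
proof -
  have "- reg \<subseteq> {w. \<not> sn analytic_on {w}}"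
    by (auto simp: reg_def dest: analytic_at_imp_no_pole)
  moreover have "{w. \<not> sn analytic_on {w}} sparse_in UNIV"
    using nicely_meromorphic(1) meromorphic_on_imp_sparse_singularities
    by (auto simp: nicely_meromorphic_on_def)
  ultimately show ?thesis by (rule sparse_in_subset2[rotated])
qed

lemma open_reg: "open reg"
  using sparse_in_UNIV_imp_closed[OF not_reg_sparse] by (simp add: closed_def)

lemma countable_not_reg: "countable (- reg)"
  using sparse_imp_countable[OF _ not_reg_sparse] by simp

lemma holomorphic_reg: "sn holomorphic_on reg" "cn holomorphic_on reg" "dn holomorphic_on reg"
  using derivs open_reg by (auto simp: holomorphic_on_open)

text \<open>The derivative rules hold on all of \<open>reg\<close>, so \<open>cn\<close> and
  \<open>dn\<close> are holomorphic there as well and one regular set serves all three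
  functions.\<close>

lemma reg_not_pole:
  assumes "z \<in> reg"
  shows "\<not> is_pole sn z" "\<not> is_pole cn z" "\<not> is_pole dn z"
proof -
  have "sn analytic_on {z}" "cn analytic_on {z}" "dn analytic_on {z}"
    using holomorphic_reg open_reg assms analytic_on_open analytic_on_subset[of _ reg "{z}"] by auto
  then show "\<not> is_pole sn z" "\<not> is_pole cn z" "\<not> is_pole dn z"
    by (auto dest: analytic_at_imp_no_pole)
qed

lemma sn_cn: assumes "z \<in> reg" shows "(cn z)\<^sup>2 = 1 - (sn z)\<^sup>2"
proof -
  have "(cn z)\<^sup>2 + (sn z)\<^sup>2 = (cn 0)\<^sup>2 + (sn 0)\<^sup>2"
    by (rule zero_derivative_const_complement_countable[OF open_reg countable_not_reg])
       (use assms in \<open>auto intro!: derivative_eq_intros derivs simp: algebra_simps\<close>)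
  then show ?thesis by (simp add: algebra_simps)
qed

lemma sn_dn: assumes "z \<in> reg" shows "(dn z)\<^sup>2 = 1 - k\<^sup>2 * (sn z)\<^sup>2"
proof -
  have "(dn z)\<^sup>2 + k\<^sup>2 * (sn z)\<^sup>2 = (dn 0)\<^sup>2 + k\<^sup>2 * (sn 0)\<^sup>2"
    by (rule zero_derivative_const_complement_countable[OF open_reg countable_not_reg])
       (use assms in \<open>auto intro!: derivative_eq_intros derivs simp: algebra_simps\<close>)
  then show ?thesis by (simp add: algebra_simps)
qed

section \<open>The addition theorem\<close>

lemma countable_affine_not_reg:
  assumes "m \<noteq> 0"
  shows "countable {u. m * u + c \<notin> reg}"
proof -
  have "{u. m * u + c \<notin> reg} \<subseteq> (\<lambda>w. (w - c) / m) ` (- reg)"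
    using assms by (force simp: image_iff)
  then show ?thesis using countable_not_reg countable_image countable_subset by blast
qed

text \<open>\<open>D c\<close> is 1 at \<open>u = 0\<close> because \<open>sn 0 = 0\<close>, and the
  hypothesis on \<open>e * c\<close> puts 0 in the domain. So \<open>D c\<close> is not identically
  zero and removes only countably many further points. The sign \<open>e\<close> lets one argument
  cover both \<open>c - u\<close> and \<open>u - c\<close>.\<close>

lemma addition_domain:
  assumes e: "e = 1 \<or> e = (-1::complex)"
  defines "D \<equiv> \<lambda>c u. 1 - k\<^sup>2 * (sn u)\<^sup>2 * (sn (e * (c - u)))\<^sup>2"
  defines "U \<equiv> \<lambda>c. {u \<in> reg. e * (c - u) \<in> reg \<and> D c u \<noteq> 0}"
  assumes c: "e * c \<in> reg"
  shows "open (U c)" "countable (- U c)"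
proof -
  have e0: "e \<noteq> 0" "e * e = 1" using e by auto
  define S where "S = {u \<in> reg. e * (c - u) \<in> reg}"
  have "S = reg \<inter> (\<lambda>u. e * (c - u)) -` reg" by (auto simp: S_def)
  then have S: "open S"
    using open_reg by (auto intro!: open_Int open_vimage continuous_intros)
  have "- S \<subseteq> - reg \<union> {u. (- e) * u + (e * c) \<notin> reg}" by (auto simp: S_def algebra_simps)
  then have cS: "countable (- S)"
    using countable_affine_not_reg[of "- e" "e * c"] countable_not_reg e0 countable_subset
    by (metis (no_types, lifting) countable_Un neg_equal_0_iff_equal)
  have hD: "D c holomorphic_on S"
  proof -
    have "sn holomorphic_on S" "(sn \<circ> (\<lambda>u. e * (c - u))) holomorphic_on S"
      by (auto intro!: holomorphic_on_compose_gen[where t = reg] holomorphic_intros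
          intro: holomorphic_on_subset[OF holomorphic_reg(1)] simp: S_def)
    then show ?thesis unfolding D_def by (auto intro!: holomorphic_intros simp: o_def)
  qed
  have "U c = S \<inter> D c -` (- {0})" by (auto simp: U_def S_def)
  then show "open (U c)"
    using S hD by (auto intro!: continuous_open_preimage holomorphic_on_imp_continuous_on)
  have "0 \<in> S" using c by (simp add: S_def)
  have "countable {u \<in> S. D c u = 0}"
  proof (cases "D c constant_on S")
    case True
    then have "D c u = D c 0" if "u \<in> S" for u
      using \<open>0 \<in> S\<close> that by (auto simp: constant_on_def)
    moreover have "D c 0 = 1" by (simp add: D_def)
    ultimately have "{u \<in> S. D c u = 0} = {}" by auto
    then show ?thesis by (metis countable_empty)
  qed (use S cS hD countable_zeros_complement_countable in auto)
  moreover have "- U c \<subseteq> - S \<union> {u \<in> S. D c u = 0}" by (auto simp: U_def S_def)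
  ultimately show "countable (- U c)" using cS countable_subset by (metis countable_Un)
qed

text \<open>For \<open>e = 1\<close> and \<open>e = -1\<close> the constant value of \<open>E c\<close>, computed at \<open>u = c\<close>, is \<open>sn c\<close>: this gives
  the addition and the subtraction theorem. For \<open>e = -1\<close> the value at \<open>u = 0\<close> shows that \<open>sn\<close> is odd.\<close>
lemma addition_const:
  assumes e: "e = 1 \<or> e = (-1::complex)"
  defines "D \<equiv> \<lambda>c u. 1 - k\<^sup>2 * (sn u)\<^sup>2 * (sn (e * (c - u)))\<^sup>2"
  defines "U \<equiv> \<lambda>c. {u \<in> reg. e * (c - u) \<in> reg \<and> D c u \<noteq> 0}"
  defines "E \<equiv> \<lambda>c u. (sn u * cn (e * (c - u)) * dn (e * (c - u)) + e * sn (e * (c - u)) * cn u * dn u) / D c u"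
  assumes c: "e * c \<in> reg" and u: "u \<in> U c" and v: "v \<in> U c"
  shows "E c u = E c v"
proof (rule zero_derivative_const_complement_countable[where f = "E c" and S = "U c"])
  show "open (U c)" "countable (- U c)"
    using addition_domain[OF e c] unfolding U_def D_def by auto
  show "u \<in> U c" "v \<in> U c" by fact+
  fix z assume z: "z \<in> U c"
  define s1 c1 d1 s2 c2 d2 where defs: "s1 = sn z" "c1 = cn z" "d1 = dn z"
    "s2 = sn (e * (c - z))" "c2 = cn (e * (c - z))" "d2 = dn (e * (c - z))"
  have ee: "e * e = 1" using e by auto
  have r: "z \<in> reg" "e * (c - z) \<in> reg" "1 - k\<^sup>2 * s1\<^sup>2 * s2\<^sup>2 \<noteq> 0"
    using z by (auto simp: U_def D_def defs)
  have q: "c1\<^sup>2 = 1 - s1\<^sup>2" "d1\<^sup>2 = 1 - k\<^sup>2 * s1\<^sup>2" "c2\<^sup>2 = 1 - s2\<^sup>2" "d2\<^sup>2 = 1 - k\<^sup>2 * s2\<^sup>2"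
    using r sn_cn sn_dn by (auto simp: defs)
  note dz = derivs_comp[where g = "\<lambda>u. e * (c - u)" and x = z and g' = "- e"]
  have lin: "((\<lambda>u. e * (c - u)) has_field_derivative - e) (at z)"
    by (auto intro!: derivative_eq_intros)
  have N: "((\<lambda>u. sn u * cn (e * (c - u)) * dn (e * (c - u)) + e * sn (e * (c - u)) * cn u * dn u)
     has_field_derivative
      (c1 * d1 * c2 * d2 + s1 * (e * s2 * d2) * d2 + s1 * c2 * (e * k\<^sup>2 * s2 * c2)
       + e * (- e * c2 * d2) * c1 * d1 + e * s2 * (- s1 * d1) * d1 + e * s2 * c1 * (- k\<^sup>2 * s1 * c1))) (at z)"
    by (rule derivative_eq_intros derivs r dz lin refl)+ (simp add: defs algebra_simps)
  have Dd: "(D c has_field_derivative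
      - (k\<^sup>2 * (2 * s1 * (c1 * d1)) * s2\<^sup>2) + k\<^sup>2 * s1\<^sup>2 * (2 * s2 * (e * c2 * d2))) (at z)"
    unfolding D_def
    by (rule derivative_eq_intros derivs r dz lin refl)+ (simp add: defs algebra_simps)
  \<comment> \<open>Preparation for the quotient rule: the derivative of the numerator is
    \<open>?R\<close>, and the numerator times the derivative of \<open>D c\<close> will turn out to
    be \<open>?R\<close> times \<open>D c\<close>, so the two terms cancel.\<close>
  have N': "(c1 * d1 * c2 * d2 + s1 * (e * s2 * d2) * d2 + s1 * c2 * (e * k\<^sup>2 * s2 * c2)
       + e * (- e * c2 * d2) * c1 * d1 + e * s2 * (- s1 * d1) * d1 + e * s2 * c1 * (- k\<^sup>2 * s1 * c1))
     = 2 * e * k\<^sup>2 * s1 * s2 * (s1\<^sup>2 - s2\<^sup>2)" (is "?N' = ?R")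
  proof -
    have "?N' = (1 - e * e) * (c1 * d1 * c2 * d2)
      + e * s1 * s2 * (d2\<^sup>2 + k\<^sup>2 * c2\<^sup>2 - d1\<^sup>2 - k\<^sup>2 * c1\<^sup>2)"
      by (simp add: algebra_simps power2_eq_square)
    also have "\<dots> = ?R"
      unfolding ee q by (simp add: algebra_simps power2_eq_square)
    finally show ?thesis .
  qed
  have "(s1 * c2 * d2 + e * s2 * c1 * d1)
        * (- (k\<^sup>2 * (2 * s1 * (c1 * d1)) * s2\<^sup>2) + k\<^sup>2 * s1\<^sup>2 * (2 * s2 * (e * c2 * d2)))
     = 2 * e * k\<^sup>2 * s1 * s2 * (s1\<^sup>2 * c2\<^sup>2 * d2\<^sup>2 - s2\<^sup>2 * c1\<^sup>2 * d1\<^sup>2)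
       + 2 * k\<^sup>2 * s1\<^sup>2 * s2\<^sup>2 * c1 * d1 * c2 * d2 * (e * e - 1)"
    by (simp add: algebra_simps power2_eq_square)
  also have "\<dots> = ?R * (1 - k\<^sup>2 * s1\<^sup>2 * s2\<^sup>2)"
    unfolding ee q by algebra
  finally have ND: "(s1 * c2 * d2 + e * s2 * c1 * d1)
        * (- (k\<^sup>2 * (2 * s1 * (c1 * d1)) * s2\<^sup>2) + k\<^sup>2 * s1\<^sup>2 * (2 * s2 * (e * c2 * d2)))
     = ?R * (1 - k\<^sup>2 * s1\<^sup>2 * s2\<^sup>2)" .
  have "(E c has_field_derivative
    (?N' * (1 - k\<^sup>2 * s1\<^sup>2 * s2\<^sup>2) - (s1 * c2 * d2 + e * s2 * c1 * d1) * (- (k\<^sup>2 * (2 * s1 * (c1 * d1)) * s2\<^sup>2) + k\<^sup>2 * s1\<^sup>2 * (2 * s2 * (e * c2 * d2))))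
      / ((1 - k\<^sup>2 * s1\<^sup>2 * s2\<^sup>2) * (1 - k\<^sup>2 * s1\<^sup>2 * s2\<^sup>2))) (at z)"
    using DERIV_divide[OF N Dd] r(3) unfolding E_def D_def defs by simp
  then show "(E c has_field_derivative 0) (at z)" unfolding N' ND by simp
qed

lemma sn_add:
  assumes "u \<in> reg" "v \<in> reg" "u + v \<in> reg" "1 - k\<^sup>2 * (sn u)\<^sup>2 * (sn v)\<^sup>2 \<noteq> 0"
  shows "sn (u + v) = (sn u * cn v * dn v + sn v * cn u * dn u) / (1 - k\<^sup>2 * (sn u)\<^sup>2 * (sn v)\<^sup>2)"
  using addition_const[of 1 "u + v" "u + v" u] assms by simp

lemma sn_diff:
  assumes "u \<in> reg" "v \<in> reg" "u - v \<in> reg" "v - u \<in> reg" "1 - k\<^sup>2 * (sn u)\<^sup>2 * (sn v)\<^sup>2 \<noteq> 0"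
  shows "sn (u - v) = (sn u * cn v * dn v - sn v * cn u * dn u) / (1 - k\<^sup>2 * (sn u)\<^sup>2 * (sn v)\<^sup>2)"
  using addition_const[of "-1" "u - v" "u - v" u] assms by simp

section \<open>Parity\<close>

lemma sn_minus_aux: assumes "u \<in> reg" "- u \<in> reg" shows "sn (- u) = - sn u"
  using addition_const[of "-1" u u 0] assms by simp

text \<open>Near \<open>- u\<close>, oddness at regular points gives
  \<open>sn w = - sn (- w)\<close>, which tends to the finite value \<open>- sn u\<close>; this is
  incompatible with a pole at \<open>- u\<close>.\<close>

lemma uminus_reg_aux: assumes K: "u \<in> reg" shows "- u \<in> reg"
proof (rule ccontr)
  assume "- u \<notin> reg"
  then have p: "is_pole sn (- u)" by (simp add: reg_def)
  have "eventually (\<lambda>w. w \<in> reg) (at (- u))"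
    using not_reg_sparse sparse_in_eventually_iff[of UNIV "- reg"] by auto
  moreover have "eventually (\<lambda>w. - w \<in> reg) (at (- u))"
    using open_reg K eventually_at_topological[of "\<lambda>w. - w \<in> reg" "- u" UNIV]
    by (intro eventually_at_topological[THEN iffD2] exI[of _ "uminus -` reg"])
       (auto intro!: open_vimage continuous_intros)
  ultimately have ev: "eventually (\<lambda>w. sn w = - sn (- w)) (at (- u))"
    by eventually_elim (use sn_minus_aux in fastforce)
  have "isCont sn u" using derivs(1)[OF K] DERIV_isCont by blast
  then have "((\<lambda>w. - sn (- w)) \<longlongrightarrow> - sn u) (at (- u))"
    by (intro tendsto_minus) (auto intro!: isCont_tendsto_compose[of u sn] tendsto_eq_intros)
  then have "(sn \<longlongrightarrow> - sn u) (at (- u))"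
    using filterlim_cong[OF refl refl ev] by blast
  then show False
    using p not_tendsto_and_filterlim_at_infinity[OF at_neq_bot] by (auto simp: is_pole_def)
qed

lemma uminus_reg [simp]: "- u \<in> reg \<longleftrightarrow> u \<in> reg"
  using uminus_reg_aux[of u] uminus_reg_aux[of "- u"] by auto

lemma sn_minus: assumes "u \<in> reg" shows "sn (- u) = - sn u"
  using sn_minus_aux assms by simp

lemma cn_minus_square: assumes "u \<in> reg" shows "(cn (- u))\<^sup>2 = (cn u)\<^sup>2"
  using sn_cn[of u] sn_cn[of "- u"] sn_minus assms by simp

text \<open>The derivative of the odd function \<open>sn\<close> is even, and that derivative is
  \<open>cn * dn\<close>.\<close>

lemma cn_dn_minus: assumes "u \<in> reg" shows "cn (- u) * dn (- u) = cn u * dn u"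
proof -
  have "((\<lambda>x. - sn (- x)) has_field_derivative cn (- u) * dn (- u)) (at u)"
    using DERIV_minus[OF derivs_comp(1)[of uminus u "-1"]] assms by (simp add: DERIV_minus[OF DERIV_ident])
  moreover have "eventually (\<lambda>x. sn x = - sn (- x)) (nhds u)"
    using eventually_nhds_in_open[OF open_reg assms] by eventually_elim (use sn_minus in simp)
  ultimately have "(sn has_field_derivative cn (- u) * dn (- u)) (at u)"
    by (simp add: DERIV_cong_ev[OF refl _ refl])
  then show ?thesis by (rule DERIV_unique[OF _ derivs(1)[OF assms]])
qed

section \<open>Critical points and countable level sets\<close>

lemma sn_not_constant: assumes "\<And>z. z \<in> reg \<Longrightarrow> sn z = c" shows False
proof -
  have "eventually (\<lambda>x. sn x = (\<lambda>_. c) x) (nhds 0)"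
    using eventually_nhds_in_open[OF open_reg zero_reg] by eventually_elim (use assms in simp)
  then have "((\<lambda>_. c) has_field_derivative 1) (at 0)"
    using derivs(1)[OF zero_reg] DERIV_cong_ev[OF refl _ refl] by fastforce
  then show False using DERIV_unique[OF _ DERIV_const] zero_neq_one by metis
qed

text \<open>Otherwise \<open>sn\<close> would omit the four values \<open>\<plusminus>1\<close> and \<open>\<plusminus>1/k\<close>, against Picard.\<close>
lemma exists_critical_point:
  assumes k: "k \<notin> {0, 1, -1}"
  obtains K where "K \<in> reg" "cn K * dn K = 0"
proof -
  have False if n: "\<And>K. K \<in> reg \<Longrightarrow> cn K * dn K \<noteq> 0"
  proof -
    obtain h f1 f2 where f: "h holomorphic_on UNIV" "f1 holomorphic_on UNIV" "f2 holomorphic_on UNIV"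
      "\<And>z. f1 z = 0 \<longleftrightarrow> \<not> is_pole sn z \<and> sn z = 0" "\<And>z. f2 z = 0 \<longleftrightarrow> is_pole sn z"
      "\<And>z. h z \<noteq> 0" "\<And>z. sn z = h z * f1 z / f2 z"
      using weierstrass_factorization_meromorphic_UNIV[OF nicely_meromorphic(1)] by metis
    define N where "N = (\<lambda>z. h z * f1 z)"
    \<comment> \<open>Clearing the denominator makes the omission of \<open>t\<close> meaningful at
      the poles too, where \<open>f2\<close> vanishes and \<open>N\<close> does not.\<close>
    have om: "N z \<noteq> t * f2 z" if t: "t = 1 \<or> t = -1 \<or> t = 1 / k" for z t
    proof (cases "z \<in> reg")
      case True
      then have f2: "f2 z \<noteq> 0" using f(5) by (simp add: reg_def)
      have "sn z \<noteq> t"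
        using n[OF True] sn_cn[OF True] sn_dn[OF True] t k by (auto simp: power_divide)
      then show ?thesis using f2 f(7)[of z] by (auto simp: N_def)
    next
      case False
      then have "is_pole sn z" by (simp add: reg_def)
      then have "f2 z = 0" "f1 z \<noteq> 0" using f(4,5) by blast+
      then show ?thesis using f(6) by (simp add: N_def)
    qed
    \<comment> \<open>\<open>g\<close> is \<open>1 / (sn - 1)\<close>, entire because
      \<open>sn\<close> omits 1, and 0 at the poles. The omitted values -1 and \<open>1 / k\<close>
      of \<open>sn\<close> become \<open>-1/2\<close> and \<open>k / (1 - k)\<close>, which differ
      since \<open>k\<close> is not -1.\<close>
    define g where "g = (\<lambda>z. f2 z / (N z - f2 z))"
    have nz: "N z - f2 z \<noteq> 0" for z using om[of 1 z] by simp
    have "g holomorphic_on UNIV"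
      using f nz unfolding g_def N_def by (auto intro!: holomorphic_intros)
    moreover have "-1/2 \<noteq> k / (1 - k)"
      using k by (auto simp: field_simps add_eq_0_iff)
    moreover have "g z \<noteq> -1/2" for z
      using nz[of z] om[of "-1" z] by (auto simp: g_def field_simps add_eq_0_iff)
    moreover have "g z \<noteq> k / (1 - k)" for z
      using nz[of z] om[of "1 / k" z] k by (auto simp: g_def field_simps)
    ultimately obtain c where c: "g = (\<lambda>_. c)"
      using little_Picard[of g "-1/2" "k / (1 - k)"] by blast
    have "f2 0 \<noteq> 0" using f(5) zero_reg by (auto simp: reg_def)
    then have "c \<noteq> 0" using fun_cong[OF c, of 0] nz[of 0] by (auto simp: g_def)
    have "sn z = 1 + 1 / c" if "z \<in> reg" for z
    proof -
      have "f2 z \<noteq> 0" using that f(5) by (simp add: reg_def)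
      moreover have "f2 z = c * (N z - f2 z)"
        using fun_cong[OF c, of z] nz[of z] by (simp add: g_def field_simps)
      moreover have "sn z * f2 z = N z" using \<open>f2 z \<noteq> 0\<close> f(7)[of z] by (simp add: N_def)
      ultimately have "f2 z * (c * sn z) = f2 z * (1 + c)" by algebra
      then have "c * sn z = 1 + c" using \<open>f2 z \<noteq> 0\<close> by simp
      then show ?thesis using \<open>c \<noteq> 0\<close> by (simp add: field_simps)
    qed
    then show False using sn_not_constant by blast
  qed
  then show thesis using that by blast
qed

text \<open>The function \<open>a * sn z ^ n - 1\<close> is -1 at 0, so in the constant case it has
  no zeros at all.\<close>

lemma countable_sn_power:
  assumes "n > 0" shows "countable {z \<in> reg. a * sn z ^ n = 1}"
proof (cases "(\<lambda>z. a * sn z ^ n - 1) constant_on reg")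
  case True
  then obtain c where c: "\<And>z. z \<in> reg \<Longrightarrow> a * sn z ^ n - 1 = c"
    unfolding constant_on_def by metis
  have "c = - 1" using c[OF zero_reg] assms by (simp add: power_0_left)
  then have "a * sn z ^ n \<noteq> 1" if "z \<in> reg" for z
    using c[OF that] \<open>c = - 1\<close> by (metis add_cancel_left_left diff_conv_add_uminus zero_neq_one)
  then have "{z \<in> reg. a * sn z ^ n = 1} = {}" by blast
  then show ?thesis by (metis countable_empty)
next
  case False
  have "(\<lambda>z. a * sn z ^ n - 1) holomorphic_on reg"
    using holomorphic_reg by (auto intro!: holomorphic_intros)
  from countable_zeros_complement_countable[OF open_reg countable_not_reg this False]
  show ?thesis by simp
qed

lemma countable_sn_zeros: "countable {z \<in> reg. sn z = 0}"
  using countable_zeros_complement_countable[OF open_reg countable_not_reg holomorphic_reg(1)]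
    sn_not_constant unfolding constant_on_def by metis

end

section \<open>Generic parameters and initial values\<close>

lemma generic_pair_mono:
  assumes P: "generic_pair P" and PQ: "\<And>x y. P x y \<Longrightarrow> Q x y"
  shows "generic_pair Q"
proof -
  from P obtain F :: "nat \<Rightarrow> complex poly poly" where "\<forall>i. F i \<noteq> 0"
    "\<forall>x y. (\<forall>i. poly (poly (F i) [:y:]) x \<noteq> 0) \<longrightarrow> P x y"
    unfolding generic_pair_def by (elim exE conjE)
  with PQ show ?thesis
    unfolding generic_pair_def by (intro exI[of _ F]) blast
qed

text \<open>A countable family of exceptional sequences is merged into a single sequence by coding
  pairs of indices.\<close>

lemma generic_pair_all:
  fixes P :: "'i :: countable \<Rightarrow> complex \<Rightarrow> complex \<Rightarrow> bool"
  assumes "\<And>i. generic_pair (P i)"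
  shows "generic_pair (\<lambda>x y. \<forall>i. P i x y)"
proof -
  have "\<forall>i. \<exists>F. (\<forall>j::nat. F j \<noteq> 0) \<and> (\<forall>x y. (\<forall>j. poly (poly (F j) [:y:]) x \<noteq> 0) \<longrightarrow> P i x y)"
    by (rule allI, rule assms[unfolded generic_pair_def])
  from choice[OF this] obtain F :: "'i \<Rightarrow> nat \<Rightarrow> complex poly poly"
    where F': "\<forall>i. (\<forall>j. F i j \<noteq> 0) \<and> (\<forall>x y. (\<forall>j. poly (poly (F i j) [:y:]) x \<noteq> 0) \<longrightarrow> P i x y)" ..
  then have F: "F i j \<noteq> 0" "(\<forall>j. poly (poly (F i j) [:y:]) x \<noteq> 0) \<Longrightarrow> P i x y" for i j x y
    by simp_all
  define G where "G n = case_prod F (from_nat n)" for n :: nat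
  have G: "G (to_nat (i, j)) = F i j" for i j by (simp add: G_def)
  show ?thesis unfolding generic_pair_def
  proof (intro exI[of _ G] conjI allI impI)
    show "G n \<noteq> 0" for n using F(1) by (simp add: G_def split: prod.split)
    show "P i x y" if "\<forall>n. poly (poly (G n) [:y:]) x \<noteq> 0" for i x y
      by (rule F(2)) (use that G in metis)
  qed
qed

lemma generic_triple_mono:
  assumes P: "generic_triple P" and PQ: "\<And>a b c. P a b c \<Longrightarrow> Q a b c"
  shows "generic_triple Q"
proof -
  have "\<exists>F. A F \<and> (\<forall>a b c. R F a b c \<longrightarrow> Q a b c)"
    if "\<exists>F. A F \<and> (\<forall>a b c. R F a b c \<longrightarrow> P a b c)"
    for A and R :: "(nat \<Rightarrow> complex \<Rightarrow> complex \<Rightarrow> complex \<Rightarrow> complex) \<Rightarrow> _"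
    using that PQ by blast
  from this[OF P[unfolded generic_triple_def]] show ?thesis unfolding generic_triple_def .
qed

lemma generic_triple_all:
  fixes P :: "'i :: countable \<Rightarrow> complex \<Rightarrow> complex \<Rightarrow> complex \<Rightarrow> bool"
  assumes "\<And>i. generic_triple (P i)"
  shows "generic_triple (\<lambda>a b c. \<forall>i. P i a b c)"
proof -
  have "\<forall>i. \<exists>F. (\<forall>j::nat. (\<forall>b c. (\<lambda>a. F j a b c) holomorphic_on UNIV) \<and>
      (\<forall>a c. (\<lambda>b. F j a b c) holomorphic_on UNIV) \<and>
      (\<forall>a b. (\<lambda>c. F j a b c) holomorphic_on UNIV) \<and> (\<exists>a b c. F j a b c \<noteq> 0)) \<and>
      (\<forall>a b c. (\<forall>j. F j a b c \<noteq> 0) \<longrightarrow> P i a b c)"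
    by (rule allI, rule assms[unfolded generic_triple_def])
  from choice[OF this] obtain F :: "'i \<Rightarrow> nat \<Rightarrow> complex \<Rightarrow> complex \<Rightarrow> complex \<Rightarrow> complex"
    where F': "\<forall>i. (\<forall>j. (\<forall>b c. (\<lambda>a. F i j a b c) holomorphic_on UNIV) \<and>
      (\<forall>a c. (\<lambda>b. F i j a b c) holomorphic_on UNIV) \<and>
      (\<forall>a b. (\<lambda>c. F i j a b c) holomorphic_on UNIV) \<and> (\<exists>a b c. F i j a b c \<noteq> 0)) \<and>
      (\<forall>a b c. (\<forall>j. F i j a b c \<noteq> 0) \<longrightarrow> P i a b c)" ..
  then have F: "(\<lambda>a. F i j a b c) holomorphic_on UNIV" "(\<lambda>b. F i j a b c) holomorphic_on UNIV"
    "(\<lambda>c. F i j a b c) holomorphic_on UNIV" "\<exists>a b c. F i j a b c \<noteq> 0"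
    "(\<forall>j. F i j a b c \<noteq> 0) \<Longrightarrow> P i a b c" for i j a b c
    by simp_all
  define G where "G n = case_prod F (from_nat n)" for n :: nat
  have G: "G (to_nat (i, j)) = F i j" for i j by (simp add: G_def)
  show ?thesis unfolding generic_triple_def
  proof (intro exI[of _ G] conjI allI impI)
    fix n a b c
    show "(\<lambda>a. G n a b c) holomorphic_on UNIV" "(\<lambda>b. G n a b c) holomorphic_on UNIV"
      "(\<lambda>c. G n a b c) holomorphic_on UNIV" "\<exists>a b c. G n a b c \<noteq> 0"
      using F(1-4) by (simp_all add: G_def split: prod.split)
  next
    show "P i a b c" if "\<forall>n. G n a b c \<noteq> 0" for i a b c
      by (rule F(5)) (use that G in metis)
  qed
qed

lemma generic_triple_conj:
  assumes "generic_triple P" "generic_triple Q"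
  shows "generic_triple (\<lambda>a b c. P a b c \<and> Q a b c)"
proof -
  have "generic_triple (\<lambda>a b c. \<forall>i::bool. (if i then P else Q) a b c)"
    by (rule generic_triple_all) (use assms in simp)
  then show ?thesis by (rule generic_triple_mono) (metis (full_types))
qed

text \<open>Each point of \<open>C\<close> contributes one affine function, nonconstant by the
  condition on the coefficients. The empty set is treated apart because it cannot be enumerated by a
  sequence of its elements.\<close>

lemma generic_triple_affine:
  assumes "countable C" "l \<noteq> 0 \<or> m \<noteq> 0 \<or> n \<noteq> 0"
  shows "generic_triple (\<lambda>a b c. l * a + m * b + n * c \<notin> C)"
proof (cases "C = {}")
  case True
  then show ?thesis
    unfolding generic_triple_def by (intro exI[of _ "\<lambda>_ _ _ _. 1"]) auto
next
  case False
  define F where "F i a b c = l * a + m * b + n * c - from_nat_into C i" for i a b c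
  have "\<exists>a b c. F i a b c \<noteq> 0" for i
  proof (rule ccontr)
    assume "\<nexists>a b c. F i a b c \<noteq> 0"
    then have z: "F i a b c = 0" for a b c by blast
    then show False
      using z[of 0 0 0] z[of 1 0 0] z[of 0 1 0] z[of 0 0 1] assms(2) by (auto simp: F_def)
  qed
  moreover have "l * a + m * b + n * c \<notin> C" if "\<forall>i. F i a b c \<noteq> 0" for a b c
    using that from_nat_into_surj[OF assms(1)] by (metis F_def eq_iff_diff_eq_0)
  ultimately show ?thesis
    unfolding generic_triple_def
    by (intro exI[of _ F]) (auto simp: F_def[abs_def] intro!: holomorphic_intros)
qed

text \<open>A tuple \<open>(a, b, c, x, y)\<close> stands for the parameters \<open>\<alpha>\<^sub>0, \<beta>\<^sub>0, \<phi>\<close> and the initial values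
  \<open>v\<^sub>0\<^sub>,\<^sub>0, v\<^sub>0\<^sub>,\<^sub>1\<close>.\<close>
type_synonym data = "complex \<times> complex \<times> complex \<times> complex \<times> complex"

text \<open>The common source of both notions of genericity: with the initial values frozen it
  yields functions permitted in \<open>generic_triple\<close>, with the parameters frozen a
  polynomial permitted in \<open>generic_pair\<close>.\<close>

definition entire_poly :: "(data \<Rightarrow> complex) \<Rightarrow> bool" where
  "entire_poly G \<longleftrightarrow>
     (\<forall>b c x y. (\<lambda>a. G (a, b, c, x, y)) holomorphic_on UNIV) \<and>
     (\<forall>a c x y. (\<lambda>b. G (a, b, c, x, y)) holomorphic_on UNIV) \<and>
     (\<forall>a b x y. (\<lambda>c. G (a, b, c, x, y)) holomorphic_on UNIV) \<and>
     (\<forall>a b c. \<exists>p :: complex poly poly. \<forall>x y. G (a, b, c, x, y) = poly (poly p [:y:]) x)"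

lemma entire_poly_const: "entire_poly (\<lambda>_. t)"
  unfolding entire_poly_def by (auto intro!: exI[of _ "[:[:t:]:]"])

lemma entire_poly_x: "entire_poly (\<lambda>(a, b, c, x, y). x)"
  unfolding entire_poly_def by (auto intro!: exI[of _ "[:[:0, 1:]:]"])

lemma entire_poly_y: "entire_poly (\<lambda>(a, b, c, x, y). y)"
  unfolding entire_poly_def by (auto intro!: exI[of _ "[:0, 1:]"])

lemma entire_poly_add:
  assumes "entire_poly F" "entire_poly G" shows "entire_poly (\<lambda>q. F q + G q)"
  unfolding entire_poly_def
proof (intro conjI allI)
  fix a b c
  obtain p q :: "complex poly poly" where "\<And>x y. F (a, b, c, x, y) = poly (poly p [:y:]) x"
    "\<And>x y. G (a, b, c, x, y) = poly (poly q [:y:]) x"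
    using assms unfolding entire_poly_def by metis
  then show "\<exists>p :: complex poly poly. \<forall>x y. F (a, b, c, x, y) + G (a, b, c, x, y) = poly (poly p [:y:]) x"
    by (intro exI[of _ "p + q"]) simp
qed (use assms in \<open>auto simp: entire_poly_def intro!: holomorphic_intros\<close>)

lemma entire_poly_mult:
  assumes "entire_poly F" "entire_poly G" shows "entire_poly (\<lambda>q. F q * G q)"
  unfolding entire_poly_def
proof (intro conjI allI)
  fix a b c
  obtain p q :: "complex poly poly" where "\<And>x y. F (a, b, c, x, y) = poly (poly p [:y:]) x"
    "\<And>x y. G (a, b, c, x, y) = poly (poly q [:y:]) x"
    using assms unfolding entire_poly_def by metis
  then show "\<exists>p :: complex poly poly. \<forall>x y. F (a, b, c, x, y) * G (a, b, c, x, y) = poly (poly p [:y:]) x"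
    by (intro exI[of _ "p * q"]) simp
qed (use assms in \<open>auto simp: entire_poly_def intro!: holomorphic_intros\<close>)

lemma entire_poly_affine:
  assumes "f holomorphic_on UNIV"
  shows "entire_poly (\<lambda>(a, b, c, x, y). f (l * a + m * b + n * c))"
proof -
  have comp: "(\<lambda>t. f (g t)) holomorphic_on UNIV" if "g holomorphic_on UNIV" for g
    using holomorphic_on_compose[OF that holomorphic_on_subset[OF assms]] by (simp add: o_def)
  have "(\<lambda>a. f (l * a + m * b + n * c)) holomorphic_on UNIV" "(\<lambda>b. f (l * a + m * b + n * c)) holomorphic_on UNIV"
    "(\<lambda>c. f (l * a + m * b + n * c)) holomorphic_on UNIV" for a b c
    by (rule comp, intro holomorphic_intros)+
  moreover have "\<exists>p :: complex poly poly. \<forall>x y. f (l * a + m * b + n * c) = poly (poly p [:y:]) x" for a b c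
    by (intro exI[of _ "[:[:f (l * a + m * b + n * c):]:]"]) simp
  ultimately show ?thesis
    unfolding entire_poly_def prod.case by (intro conjI allI)
qed

text \<open>Regularity at a single point \<open>q\<close> makes \<open>f\<close> a quotient globally, off the zeros of \<open>D\<close>. A value
  \<open>f q \<noteq> 0\<close> at one point therefore yields \<open>f \<noteq> 0\<close> for generic parameters and generic initial
  values. Where \<open>D\<close> vanishes, \<open>f\<close> may take the junk values of poles and of division by zero.\<close>
definition regular_at :: "data \<Rightarrow> (data \<Rightarrow> complex) \<Rightarrow> bool" where
  "regular_at q f \<longleftrightarrow> (\<exists>N D. entire_poly N \<and> entire_poly D \<and> D q \<noteq> 0 \<and> (\<forall>p. D p \<noteq> 0 \<longrightarrow> f p = N p / D p))"

section \<open>Closure properties of regular functions\<close>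

lemma regular_at_entire: "entire_poly f \<Longrightarrow> regular_at q f"
  unfolding regular_at_def using entire_poly_const[of 1] by (intro exI[of _ f] exI[of _ "\<lambda>_. 1"]) auto

lemmas regular_at_const = regular_at_entire[OF entire_poly_const]
lemmas regular_at_x = regular_at_entire[OF entire_poly_x]
lemmas regular_at_y = regular_at_entire[OF entire_poly_y]

lemma regular_at_mult:
  assumes "regular_at q f" "regular_at q g" shows "regular_at q (\<lambda>p. f p * g p)"
proof -
  obtain N D N' D' where "entire_poly N" "entire_poly D" "D q \<noteq> 0" "\<And>p. D p \<noteq> 0 \<Longrightarrow> f p = N p / D p"
    "entire_poly N'" "entire_poly D'" "D' q \<noteq> 0" "\<And>p. D' p \<noteq> 0 \<Longrightarrow> g p = N' p / D' p"
    using assms unfolding regular_at_def by metis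
  then show ?thesis unfolding regular_at_def
    by (intro exI[of _ "\<lambda>p. N p * N' p"] exI[of _ "\<lambda>p. D p * D' p"]) (auto intro: entire_poly_mult)
qed

lemma regular_at_add:
  assumes "regular_at q f" "regular_at q g" shows "regular_at q (\<lambda>p. f p + g p)"
proof -
  obtain N D N' D' where "entire_poly N" "entire_poly D" "D q \<noteq> 0" "\<And>p. D p \<noteq> 0 \<Longrightarrow> f p = N p / D p"
    "entire_poly N'" "entire_poly D'" "D' q \<noteq> 0" "\<And>p. D' p \<noteq> 0 \<Longrightarrow> g p = N' p / D' p"
    using assms unfolding regular_at_def by metis
  then show ?thesis unfolding regular_at_def
    by (intro exI[of _ "\<lambda>p. N p * D' p + N' p * D p"] exI[of _ "\<lambda>p. D p * D' p"])
       (auto intro!: entire_poly_mult entire_poly_add simp: field_simps)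
qed

lemma regular_at_minus: "regular_at q f \<Longrightarrow> regular_at q (\<lambda>p. - f p)"
  using regular_at_mult[OF regular_at_const[of q "-1"]] by simp

lemma regular_at_diff:
  "regular_at q f \<Longrightarrow> regular_at q g \<Longrightarrow> regular_at q (\<lambda>p. f p - g p)"
  using regular_at_add[of q f "\<lambda>p. - g p"] regular_at_minus by simp

lemma regular_at_power: "regular_at q f \<Longrightarrow> regular_at q (\<lambda>p. f p ^ n)"
  by (induction n) (auto intro: regular_at_const regular_at_mult)

text \<open>The factor \<open>D'\<close> is kept in the new denominator, and compensated in the
  numerator, so that wherever the new denominator is nonzero the representation of \<open>g\<close>
  is still available.\<close>

lemma regular_at_divide:
  assumes "regular_at q f" "regular_at q g" "g q \<noteq> 0" shows "regular_at q (\<lambda>p. f p / g p)"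
proof -
  obtain N D N' D' where *: "entire_poly N" "entire_poly D" "D q \<noteq> 0" "\<And>p. D p \<noteq> 0 \<Longrightarrow> f p = N p / D p"
    "entire_poly N'" "entire_poly D'" "D' q \<noteq> 0" "\<And>p. D' p \<noteq> 0 \<Longrightarrow> g p = N' p / D' p"
    using assms unfolding regular_at_def by metis
  moreover have "N' q \<noteq> 0" using *(7) *(8)[of q] assms(3) by auto
  ultimately show ?thesis unfolding regular_at_def
    by (intro exI[of _ "\<lambda>p. N p * D' p * D' p"] exI[of _ "\<lambda>p. D p * D' p * N' p"])
       (auto intro!: entire_poly_mult)
qed

lemmas regular_at_intros = regular_at_const regular_at_add regular_at_mult regular_at_minus
  regular_at_diff regular_at_power regular_at_divide

text \<open>By Weierstrass factorization \<open>f\<close> is a quotient of entire functions on the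
  whole plane, with a denominator vanishing exactly at the poles; an affine substitution keeps both
  parts entire in each parameter.\<close>

lemma regular_at_meromorphic_affine:
  assumes "f nicely_meromorphic_on UNIV"
    and "\<And>a b c x y. L (a, b, c, x, y) = l * a + m * b + n * c" and "\<not> is_pole f (L q)"
  shows "regular_at q (\<lambda>p. f (L p))"
proof -
  obtain h f1 f2 where f: "h holomorphic_on UNIV" "f1 holomorphic_on UNIV" "f2 holomorphic_on UNIV"
    "\<And>z. f2 z = 0 \<longleftrightarrow> is_pole f z" "\<And>z. f z = h z * f1 z / f2 z"
    using weierstrass_factorization_meromorphic_UNIV[OF assms(1)] by metis
  have L: "L = (\<lambda>(a, b, c, x, y). l * a + m * b + n * c)" using assms(2) by auto
  have "entire_poly (\<lambda>p. g (L p))" if "g holomorphic_on UNIV" for g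
    using entire_poly_affine[OF that, of l m n] unfolding L by (simp add: case_prod_unfold)
  then show ?thesis
    unfolding regular_at_def using f assms(3)
    by (intro exI[of _ "\<lambda>p. h (L p) * f1 (L p)"] exI[of _ "\<lambda>p. f2 (L p)"]) (auto intro!: entire_poly_mult)
qed

text \<open>Frozen at \<open>x0\<close>, \<open>y0\<close>, the product \<open>N * D\<close> is an
  entire function of the parameters that is not identically zero. Where it is nonzero, the
  polynomial belonging to those parameters has a nonzero value and so is not the zero polynomial.
  The first conjunct serves functions of the parameters alone.\<close>

lemma regular_at_generic_nonzero:
  assumes "regular_at (a0, b0, c0, x0, y0) f" "f (a0, b0, c0, x0, y0) \<noteq> 0"
  shows "generic_triple (\<lambda>a b c. f (a, b, c, x0, y0) \<noteq> 0 \<and> generic_pair (\<lambda>x y. f (a, b, c, x, y) \<noteq> 0))"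
proof -
  obtain N D where ND: "entire_poly N" "entire_poly D" "D (a0, b0, c0, x0, y0) \<noteq> 0"
    "\<And>p. D p \<noteq> 0 \<Longrightarrow> f p = N p / D p"
    using assms(1) unfolding regular_at_def by metis
  define G where "G = (\<lambda>p. N p * D p)"
  have G: "entire_poly G" "G (a0, b0, c0, x0, y0) \<noteq> 0" "\<And>p. G p \<noteq> 0 \<Longrightarrow> f p \<noteq> 0"
    using ND assms(2) by (auto simp: G_def intro: entire_poly_mult)
  show ?thesis unfolding generic_triple_def
  proof (intro exI[of _ "\<lambda>_ a b c. G (a, b, c, x0, y0)"] conjI allI impI)
    fix a b c
    show "(\<lambda>a. G (a, b, c, x0, y0)) holomorphic_on UNIV" "(\<lambda>b. G (a, b, c, x0, y0)) holomorphic_on UNIV"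
      "(\<lambda>c. G (a, b, c, x0, y0)) holomorphic_on UNIV" using G(1) by (auto simp: entire_poly_def)
    show "\<exists>a b c. G (a, b, c, x0, y0) \<noteq> 0" using G(2) by blast
    assume "\<forall>i::nat. G (a, b, c, x0, y0) \<noteq> 0"
    then have nz: "G (a, b, c, x0, y0) \<noteq> 0" by simp
    then show "f (a, b, c, x0, y0) \<noteq> 0" using G(3) by blast
    obtain p :: "complex poly poly" where p: "\<And>x y. G (a, b, c, x, y) = poly (poly p [:y:]) x"
      using G(1) unfolding entire_poly_def by blast
    then have "p \<noteq> 0" using nz by auto
    then show "generic_pair (\<lambda>x y. f (a, b, c, x, y) \<noteq> 0)"
      unfolding generic_pair_def using p G(3) by (intro exI[of _ "\<lambda>_. p"]) auto
  qed
qed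

section \<open>Solving the quad equation and the difference equation\<close>

text \<open>With equal middle corners and a = g + z, b = g - z, the parameters enter
  \<open>Q4\<close> only through \<open>sn a - sn b\<close>, \<open>sn a * sn b\<close> and
  \<open>sn (a - b)\<close>. The addition theorem gives \<open>2 * sn z * cn g * dn g / D1\<close>,
  \<open>(cn^2 z - cn^2 g) / D1\<close> and \<open>2 * sn z * cn z * dn z / D2\<close> for
  them.\<close>

lemma (in jacobi) Q4_diagonal_iff:
  assumes "r\<^sup>2 = k" "k \<noteq> 0"
    and reg: "z \<in> reg" "g \<in> reg" "g + z \<in> reg" "g - z \<in> reg" "z + z \<in> reg"
    and nz: "sn z \<noteq> 0" "1 - k\<^sup>2 * sn z ^ 4 \<noteq> 0" "1 - k\<^sup>2 * (sn z)\<^sup>2 * (sn g)\<^sup>2 \<noteq> 0"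
  shows "Q4 k sn (g + z) (g - z) (r * w) (r * x) (r * x) (r * t) = 0 \<longleftrightarrow>
    cn g * dn g * (1 - k\<^sup>2 * sn z ^ 4) * x * (t + w)
    - cn z * dn z * (1 - k\<^sup>2 * (sn z)\<^sup>2 * (sn g)\<^sup>2) * (t * w + x\<^sup>2)
    + ((cn z)\<^sup>2 - (cn g)\<^sup>2) * cn z * dn z * (1 + k\<^sup>2 * x\<^sup>2 * t * w) = 0"
    (is "?Q = 0 \<longleftrightarrow> ?E = 0")
proof -
  define D1 D2 where D: "D1 = 1 - k\<^sup>2 * (sn z)\<^sup>2 * (sn g)\<^sup>2" "D2 = 1 - k\<^sup>2 * sn z ^ 4"
  have "D1 \<noteq> 0" "D2 \<noteq> 0" and D1': "1 - k\<^sup>2 * (sn g)\<^sup>2 * (sn z)\<^sup>2 = D1"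
    using nz by (simp_all add: D mult_ac)
  define p q where pq: "p = sn g * cn z * dn z" "q = sn z * cn g * dn g"
  have "z - g \<in> reg" using uminus_reg[of "g - z"] reg(4) by simp
  then have ab: "sn (g + z) * D1 = p + q" "sn (g - z) * D1 = p - q"
    using sn_add[OF reg(2,1,3), unfolded D1'] sn_diff[OF reg(2,1,4) _ _, unfolded D1'] \<open>D1 \<noteq> 0\<close> \<open>z - g \<in> reg\<close>
    by (simp_all add: pq)
  have D2': "1 - k\<^sup>2 * (sn z)\<^sup>2 * (sn z)\<^sup>2 = D2" by (simp add: D)
  have c: "sn (z + z) * D2 = 2 * sn z * cn z * dn z"
    using sn_add[OF reg(1,1,5), unfolded D2'] \<open>D2 \<noteq> 0\<close> by simp
  \<comment> \<open>The product of \<open>p + q\<close> and \<open>p - q\<close> contains a factor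
    \<open>D1\<close>, so \<open>sn (g + z) * sn (g - z)\<close> has the denominator
    \<open>D1\<close> and not its square.\<close>
  have "p * p - q * q = (sn g)\<^sup>2 * (cn z)\<^sup>2 * (dn z)\<^sup>2 - (sn z)\<^sup>2 * (cn g)\<^sup>2 * (dn g)\<^sup>2"
    by (simp add: pq power2_eq_square algebra_simps)
  also have "\<dots> = ((sn g)\<^sup>2 - (sn z)\<^sup>2) * D1"
    unfolding sn_cn[OF reg(1)] sn_dn[OF reg(1)] sn_cn[OF reg(2)] sn_dn[OF reg(2)] D by algebra
  finally have "(sn (g + z) * D1) * (sn (g - z) * D1) = ((cn z)\<^sup>2 - (cn g)\<^sup>2) * D1"
    unfolding ab by (simp add: sn_cn reg algebra_simps)
  then have ab': "sn (g + z) * sn (g - z) * D1 = (cn z)\<^sup>2 - (cn g)\<^sup>2"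
    using \<open>D1 \<noteq> 0\<close> by (simp add: mult_ac)
  have "?Q * (D1 * D2) = k * D2 * (sn (g + z) * D1 - sn (g - z) * D1) * x * (t + w)
      - k * (sn (z + z) * D2) * (D1 * (t * w + x\<^sup>2)
        - (sn (g + z) * sn (g - z) * D1) * (1 + k\<^sup>2 * x\<^sup>2 * t * w))"
    unfolding Q4_def \<open>r\<^sup>2 = k\<close>[symmetric] by (simp add: algebra_simps power2_eq_square)
  also have "\<dots> = 2 * k * sn z * ?E"
    unfolding ab ab' c by (simp add: D pq algebra_simps)
  finally have "?Q * (D1 * D2) = 2 * k * sn z * ?E" .
  moreover have "D1 * D2 \<noteq> 0" "2 * k * sn z \<noteq> 0"
    using \<open>D1 \<noteq> 0\<close> \<open>D2 \<noteq> 0\<close> nz(1) assms(2) by simp_all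
  ultimately show ?thesis by (metis mult_eq_0_iff)
qed

lemma linear_eq_0_iff:
  fixes D :: complex
  assumes "D \<noteq> 0" shows "D * v + N = 0 \<longleftrightarrow> v = - N / D"
  using assms by (auto simp: field_simps eq_neg_iff_add_eq_0)

context fixes k :: complex begin

text \<open>\<open>Q4\<close> is affine in each corner value; this is the coefficient of the corner
  \<open>y\<close>, with \<open>A\<close>, \<open>B\<close>, \<open>C\<close> for
  \<open>sn a\<close>, \<open>sn b\<close>, \<open>sn (a - b)\<close>.\<close>

definition quad_den :: "complex \<Rightarrow> complex \<Rightarrow> complex \<Rightarrow> complex \<Rightarrow> complex \<Rightarrow> complex \<Rightarrow> complex" where
  "quad_den A B C w x z = A * z - B * w - C * (x - k * A * B * w * x * z)"

definition quad_sol :: "complex \<Rightarrow> complex \<Rightarrow> complex \<Rightarrow> complex \<Rightarrow> complex \<Rightarrow> complex \<Rightarrow> complex" where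
  "quad_sol A B C w x z = - (A * w * x - B * x * z - C * (w * z - k * A * B)) / quad_den A B C w x z"

lemma quad_sol_iff:
  assumes "quad_den A B C w x z \<noteq> 0"
  shows "A * (w * x + y * z) - B * (w * y + x * z) - C * (x * y + w * z - k * A * B * (1 + w * x * y * z)) = 0
    \<longleftrightarrow> y = quad_sol A B C w x z"
proof -
  have "A * (w * x + y * z) - B * (w * y + x * z) - C * (x * y + w * z - k * A * B * (1 + w * x * y * z))
    = quad_den A B C w x z * y + (A * w * x - B * x * z - C * (w * z - k * A * B))"
    by (simp add: quad_den_def algebra_simps)
  then show ?thesis
    unfolding quad_sol_def by (simp only: linear_eq_0_iff[OF assms])
qed

text \<open>Coefficient of the next term in the difference equation, \<open>u\<close> being the
  current and \<open>w\<close> the previous term. The equation is symmetric in the two neighbours,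
  so backward steps use the same expression.\<close>

definition step_den :: "complex \<Rightarrow> complex \<Rightarrow> complex \<Rightarrow> complex \<Rightarrow> complex \<Rightarrow> complex" where
  "step_den e c d u w = e * u - c * w + d * k\<^sup>2 * u\<^sup>2 * w"

definition step_sol :: "complex \<Rightarrow> complex \<Rightarrow> complex \<Rightarrow> complex \<Rightarrow> complex \<Rightarrow> complex" where
  "step_sol e c d u w = - (e * u * w - c * u\<^sup>2 + d) / step_den e c d u w"

lemma step_sol_iff:
  assumes "step_den e c d u w \<noteq> 0"
  shows "e * u * (v + w) - c * (v * w + u\<^sup>2) + d * (1 + k\<^sup>2 * u\<^sup>2 * v * w) = 0 \<longleftrightarrow> v = step_sol e c d u w"
proof -
  have "e * u * (v + w) - c * (v * w + u\<^sup>2) + d * (1 + k\<^sup>2 * u\<^sup>2 * v * w)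
    = step_den e c d u w * v + (e * u * w - c * u\<^sup>2 + d)"
    by (simp add: step_den_def algebra_simps)
  then show ?thesis
    unfolding step_sol_def by (simp only: linear_eq_0_iff[OF assms])
qed

fun step_seq :: "(nat \<Rightarrow> complex) \<Rightarrow> (nat \<Rightarrow> complex) \<Rightarrow> (nat \<Rightarrow> complex) \<Rightarrow> complex \<Rightarrow> complex \<Rightarrow> nat \<Rightarrow> complex" where
  "step_seq e c d g0 g1 0 = g0"
| "step_seq e c d g0 g1 (Suc 0) = g1"
| "step_seq e c d g0 g1 (Suc (Suc j)) =
     step_sol (e j) (c j) (d j) (step_seq e c d g0 g1 (Suc j)) (step_seq e c d g0 g1 j)"

text \<open>Rows run parallel to the diagonal, so each new entry needs only the two preceding rows
  and the recursion is on the distance from the diagonal.\<close>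

fun quad_rows :: "(nat \<Rightarrow> int \<Rightarrow> complex) \<Rightarrow> (nat \<Rightarrow> int \<Rightarrow> complex) \<Rightarrow> (nat \<Rightarrow> int \<Rightarrow> complex) \<Rightarrow>
    (int \<Rightarrow> complex) \<Rightarrow> (int \<Rightarrow> complex) \<Rightarrow> nat \<Rightarrow> int \<Rightarrow> complex" where
  "quad_rows A B C r0 r1 0 n = r0 n"
| "quad_rows A B C r0 r1 (Suc 0) n = r1 n"
| "quad_rows A B C r0 r1 (Suc (Suc j)) n =
     quad_sol (A j n) (B j n) (C j n) (quad_rows A B C r0 r1 (Suc j) n)
       (quad_rows A B C r0 r1 j (n + 1)) (quad_rows A B C r0 r1 (Suc j) (n + 1))"

text \<open>The denominators are known to be nonzero only along the computed sequence; carrying two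
  consecutive equalities through the induction transfers this to \<open>g\<close>.\<close>

lemma step_seq_unique:
  assumes "\<And>j. step_den (e j) (c j) (d j) (step_seq e c d g0 g1 (Suc j)) (step_seq e c d g0 g1 j) \<noteq> 0"
  shows "(\<forall>j. g j = step_seq e c d g0 g1 j) \<longleftrightarrow> g 0 = g0 \<and> g 1 = g1 \<and>
    (\<forall>j. e j * g (Suc j) * (g (Suc (Suc j)) + g j) - c j * (g (Suc (Suc j)) * g j + (g (Suc j))\<^sup>2)
       + d j * (1 + k\<^sup>2 * (g (Suc j))\<^sup>2 * g (Suc (Suc j)) * g j) = 0)"
    (is "?L \<longleftrightarrow> ?R")
proof
  assume ?L
  then show ?R using step_sol_iff[OF assms] by simp
next
  assume R: ?R
  have "g j = step_seq e c d g0 g1 j \<and> g (Suc j) = step_seq e c d g0 g1 (Suc j)" for j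
  proof (induction j)
    case (Suc j)
    with R have "g (Suc (Suc j)) = step_sol (e j) (c j) (d j) (step_seq e c d g0 g1 (Suc j)) (step_seq e c d g0 g1 j)"
      using step_sol_iff[OF assms, of j "g (Suc (Suc j))"] by metis
    then show ?case using Suc by simp
  qed (use R in simp)
  then show ?L by blast
qed

lemma quad_rows_unique:
  assumes "\<And>j n. quad_den (A j n) (B j n) (C j n) (quad_rows A B C r0 r1 (Suc j) n)
       (quad_rows A B C r0 r1 j (n + 1)) (quad_rows A B C r0 r1 (Suc j) (n + 1)) \<noteq> 0"
  shows "(\<forall>j n. R j n = quad_rows A B C r0 r1 j n) \<longleftrightarrow> (\<forall>n. R 0 n = r0 n) \<and> (\<forall>n. R 1 n = r1 n) \<and>
    (\<forall>j n. A j n * (R (Suc j) n * R j (n + 1) + R (Suc (Suc j)) n * R (Suc j) (n + 1))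
      - B j n * (R (Suc j) n * R (Suc (Suc j)) n + R j (n + 1) * R (Suc j) (n + 1))
      - C j n * (R j (n + 1) * R (Suc (Suc j)) n + R (Suc j) n * R (Suc j) (n + 1)
        - k * A j n * B j n * (1 + R (Suc j) n * R j (n + 1) * R (Suc (Suc j)) n * R (Suc j) (n + 1))) = 0)"
    (is "?L \<longleftrightarrow> ?R")
proof
  assume ?L
  then show ?R using quad_sol_iff[OF assms] by simp
next
  assume R: ?R
  have "(\<forall>n. R j n = quad_rows A B C r0 r1 j n) \<and> (\<forall>n. R (Suc j) n = quad_rows A B C r0 r1 (Suc j) n)" for j
  proof (induction j)
    case (Suc j)
    have "R (Suc (Suc j)) n = quad_rows A B C r0 r1 (Suc (Suc j)) n" for n
    proof -
      have "A j n * (R (Suc j) n * R j (n + 1) + R (Suc (Suc j)) n * R (Suc j) (n + 1))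
      - B j n * (R (Suc j) n * R (Suc (Suc j)) n + R j (n + 1) * R (Suc j) (n + 1))
      - C j n * (R j (n + 1) * R (Suc (Suc j)) n + R (Suc j) n * R (Suc j) (n + 1)
        - k * A j n * B j n * (1 + R (Suc j) n * R j (n + 1) * R (Suc (Suc j)) n * R (Suc j) (n + 1))) = 0"
        using R by blast
      then show ?thesis
        using Suc quad_sol_iff[OF assms, of j n "R (Suc (Suc j)) n"] by simp
    qed
    then show ?case using Suc by simp
  qed (use R in simp)
  then show ?L by blast
qed

end

section \<open>The constrained lattice system\<close>

locale diagonal_Q4 = jacobi +
  fixes r :: complex
  assumes modulus: "k \<notin> {0, 1, -1}" and sqrt_modulus: "r\<^sup>2 = k"
begin

lemma k_nonzero: "k \<noteq> 0" and r_nonzero: "r \<noteq> 0"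
  using modulus sqrt_modulus by auto

section \<open>The solution as a function of parameters and initial values\<close>

definition alpha :: "int \<Rightarrow> data \<Rightarrow> complex" where
  "alpha n = (\<lambda>(a, b, c, x, y). a + of_int n * c)"
definition beta :: "int \<Rightarrow> data \<Rightarrow> complex" where
  "beta n = (\<lambda>(a, b, c, x, y). b - of_int n * c)"
text \<open>Left in the unsimplified shape of the difference equation, so that both unfold to the
  same term. In value, \<open>zeta (n + m)\<close> is half of
  \<open>alpha n - beta m\<close>.\<close>

definition zeta :: "int \<Rightarrow> data \<Rightarrow> complex" where
  "zeta n = (\<lambda>(a, b, c, x, y). ((a + b) / 2 + (c - a - b) / 2) * of_int n + (a - b) / 2)"
definition gam :: "int \<Rightarrow> data \<Rightarrow> complex" where
  "gam n = (\<lambda>(a, b, c, x, y). if even n then (a + b) / 2 else (c - a - b) / 2)"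
definition init_x :: "data \<Rightarrow> complex" where "init_x = (\<lambda>(a, b, c, x, y). x)"
definition init_y :: "data \<Rightarrow> complex" where "init_y = (\<lambda>(a, b, c, x, y). y)"

definition coef_e :: "int \<Rightarrow> data \<Rightarrow> complex" where
  "coef_e n q = cn (gam n q) * dn (gam n q) * (1 - k ^ 2 * sn (zeta n q) ^ 4)"
definition coef_c :: "int \<Rightarrow> data \<Rightarrow> complex" where
  "coef_c n q = cn (zeta n q) * dn (zeta n q) * (1 - k ^ 2 * sn (zeta n q) ^ 2 * sn (gam n q) ^ 2)"
definition coef_d :: "int \<Rightarrow> data \<Rightarrow> complex" where
  "coef_d n q = (cn (zeta n q) ^ 2 - cn (gam n q) ^ 2) * cn (zeta n q) * dn (zeta n q)"

definition ell_at :: "data \<Rightarrow> (int \<Rightarrow> complex) \<Rightarrow> int \<Rightarrow> bool" where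
  "ell_at q u n \<longleftrightarrow> coef_e n q * u n * (u (n + 1) + u (n - 1)) - coef_c n q * (u (n + 1) * u (n - 1) + u n ^ 2)
     + coef_d n q * (1 + k ^ 2 * u n ^ 2 * u (n + 1) * u (n - 1)) = 0"

lemma elliptic_difference_equation_iff:
  "elliptic_difference_equation k sn cn dn ((a - b) / 2) ((a + b) / 2) ((c - a - b) / 2) u
    \<longleftrightarrow> (\<forall>n. ell_at (a, b, c, x, y) u n)"
  unfolding elliptic_difference_equation_def ell_at_def coef_e_def coef_c_def coef_d_def
    zeta_def gam_def prod.case Let_def ..

text \<open>\<open>up q j\<close> is \<open>u\<^sub>j\<^sub>-\<^sub>1\<close> and \<open>down q j\<close> is \<open>u\<^sub>-\<^sub>j\<close>.\<close>
definition up :: "data \<Rightarrow> nat \<Rightarrow> complex" where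
  "up q = step_seq k (\<lambda>j. coef_e (int j) q) (\<lambda>j. coef_c (int j) q) (\<lambda>j. coef_d (int j) q)
     (init_x q / r) (init_y q / r)"
definition down :: "data \<Rightarrow> nat \<Rightarrow> complex" where
  "down q = step_seq k (\<lambda>j. coef_e (- 1 - int j) q) (\<lambda>j. coef_c (- 1 - int j) q)
     (\<lambda>j. coef_d (- 1 - int j) q) (init_y q / r) (init_x q / r)"

definition diag :: "data \<Rightarrow> int \<Rightarrow> complex" where
  "diag q i = (if i \<ge> - 1 then up q (nat (i + 1)) else down q (nat (- i)))"

definition up_den :: "nat \<Rightarrow> data \<Rightarrow> complex" where
  "up_den j q = step_den k (coef_e (int j) q) (coef_c (int j) q) (coef_d (int j) q) (up q (Suc j)) (up q j)"
definition down_den :: "nat \<Rightarrow> data \<Rightarrow> complex" where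
  "down_den j q = step_den k (coef_e (- 1 - int j) q) (coef_c (- 1 - int j) q) (coef_d (- 1 - int j) q)
     (down q (Suc j)) (down q j)"

lemma up_0_1: "up q 0 = init_x q / r" "up q 1 = init_y q / r" "up q (Suc 0) = init_y q / r"
  and down_0_1: "down q 0 = init_y q / r" "down q 1 = init_x q / r" "down q (Suc 0) = init_x q / r"
  by (simp_all add: up_def down_def)

lemma eq_diag_iff_up_down:
  "u = diag q \<longleftrightarrow> (\<forall>j. u (int j - 1) = up q j) \<and> (\<forall>j. u (- int j) = down q j)"
proof
  assume u: "u = diag q"
  have "u (int j - 1) = up q j" for j using u by (simp add: diag_def)
  moreover have "u (- int j) = down q j" for j
  proof -
    \<comment> \<open>At the indices 0 and -1 \<open>diag\<close> reads from \<open>up\<close>,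
      where both half sequences carry the same initial values.\<close>
    consider "j = 0" | "j = 1" | "- int j < - 1" by linarith
    then show ?thesis using u by cases (simp_all add: diag_def up_0_1 down_0_1)
  qed
  ultimately show "(\<forall>j. u (int j - 1) = up q j) \<and> (\<forall>j. u (- int j) = down q j)" by blast
next
  assume u: "(\<forall>j. u (int j - 1) = up q j) \<and> (\<forall>j. u (- int j) = down q j)"
  show "u = diag q"
  proof
    fix i
    show "u i = diag q i"
    proof (cases "i \<ge> - 1")
      case True
      with u[THEN conjunct1, rule_format, of "nat (i + 1)"] show ?thesis by (simp add: diag_def)
    next
      case False
      with u[THEN conjunct2, rule_format, of "nat (- i)"] show ?thesis by (simp add: diag_def)
    qed
  qed
qed

text \<open>Separates the equations solved forwards from those solved backwards: index
  \<open>j\<close> yields \<open>u (j + 1)\<close>, index \<open>- 1 - j\<close> yields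
  \<open>u (- j - 2)\<close>.\<close>

lemma all_int_iff: "(\<forall>n. P n) \<longleftrightarrow> (\<forall>j. P (int j)) \<and> (\<forall>j. P (- 1 - int j))" for P :: "int \<Rightarrow> bool"
proof (intro iffI allI)
  fix n assume *: "(\<forall>j. P (int j)) \<and> (\<forall>j. P (- 1 - int j))"
  show "P n"
  proof (cases "n \<ge> 0")
    case True
    with * show ?thesis by (metis nat_0_le)
  next
    case False
    then have "n = - 1 - int (nat (- 1 - n))" by simp
    with * show ?thesis by metis
  qed
qed simp

lemma eq_diag_iff:
  assumes "\<And>j. up_den j q \<noteq> 0" "\<And>j. down_den j q \<noteq> 0"
  shows "u = diag q \<longleftrightarrow> (\<forall>n. ell_at q u n) \<and> u (- 1) = init_x q / r \<and> u 0 = init_y q / r"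
proof -
  have "(\<forall>j. u (int j - 1) = up q j) \<longleftrightarrow> u (- 1) = init_x q / r \<and> u 0 = init_y q / r \<and> (\<forall>j. ell_at q u (int j))"
    using step_seq_unique[OF assms(1)[unfolded up_den_def up_def], where g = "\<lambda>j. u (int j - 1)"]
    by (simp add: up_def ell_at_def add.commute)
  moreover have "(\<forall>j. u (- int j) = down q j) \<longleftrightarrow>
      u 0 = init_y q / r \<and> u (- 1) = init_x q / r \<and> (\<forall>j. ell_at q u (- 1 - int j))"
    using step_seq_unique[OF assms(2)[unfolded down_den_def down_def], where g = "\<lambda>j. u (- int j)"]
    by (simp add: down_def ell_at_def algebra_simps)
  ultimately show ?thesis
    unfolding eq_diag_iff_up_down all_int_iff[of "ell_at q u"] by blast
qed

text \<open>\<open>upper_rows q j n\<close> is \<open>v\<^sub>n\<^sub>,\<^sub>n\<^sub>+\<^sub>j\<^sub>+\<^sub>1\<close> and \<open>lower_rows q j n\<close> is \<open>v\<^sub>n\<^sub>+\<^sub>j\<^sub>,\<^sub>n\<close>; the latter solves the quad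
  equation with the roles of \<open>\<alpha>\<close> and \<open>\<beta>\<close> exchanged, hence the sign of the third coefficient.\<close>
definition upper_rows :: "data \<Rightarrow> nat \<Rightarrow> int \<Rightarrow> complex" where
  "upper_rows q = quad_rows k (\<lambda>j n. sn (alpha n q)) (\<lambda>j n. sn (beta (n + int j + 2) q))
     (\<lambda>j n. sn (alpha n q - beta (n + int j + 2) q)) (\<lambda>n. r * diag q (2 * n)) (\<lambda>n. r * diag q (2 * n + 1))"
definition lower_rows :: "data \<Rightarrow> nat \<Rightarrow> int \<Rightarrow> complex" where
  "lower_rows q = quad_rows k (\<lambda>j n. sn (beta n q)) (\<lambda>j n. sn (alpha (n + int j + 1) q))
     (\<lambda>j n. - sn (alpha (n + int j + 1) q - beta n q)) (\<lambda>n. r * diag q (2 * n - 1)) (\<lambda>n. r * diag q (2 * n))"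

definition upper_den :: "nat \<Rightarrow> int \<Rightarrow> data \<Rightarrow> complex" where
  "upper_den j n q = quad_den k (sn (alpha n q)) (sn (beta (n + int j + 2) q))
     (sn (alpha n q - beta (n + int j + 2) q)) (upper_rows q (Suc j) n) (upper_rows q j (n + 1)) (upper_rows q (Suc j) (n + 1))"
definition lower_den :: "nat \<Rightarrow> int \<Rightarrow> data \<Rightarrow> complex" where
  "lower_den j n q = quad_den k (sn (beta n q)) (sn (alpha (n + int j + 1) q))
     (- sn (alpha (n + int j + 1) q - beta n q)) (lower_rows q (Suc j) n) (lower_rows q j (n + 1)) (lower_rows q (Suc j) (n + 1))"

definition lattice :: "data \<Rightarrow> int \<Rightarrow> int \<Rightarrow> complex" where
  "lattice q n m = (if m > n then upper_rows q (nat (m - n - 1)) n else lower_rows q (nat (n - m)) m)"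

lemma eq_lattice_iff_rows:
  "v = lattice q \<longleftrightarrow> (\<forall>j n. v n (n + int j + 1) = upper_rows q j n) \<and> (\<forall>j n. v (n + int j) n = lower_rows q j n)"
proof
  assume "v = lattice q"
  then show "(\<forall>j n. v n (n + int j + 1) = upper_rows q j n) \<and> (\<forall>j n. v (n + int j) n = lower_rows q j n)"
    by (simp add: lattice_def)
next
  assume v: "(\<forall>j n. v n (n + int j + 1) = upper_rows q j n) \<and> (\<forall>j n. v (n + int j) n = lower_rows q j n)"
  show "v = lattice q"
  proof (intro ext)
    fix n m
    show "v n m = lattice q n m"
      using v[THEN conjunct1, rule_format, of n "nat (m - n - 1)"]
        v[THEN conjunct2, rule_format, of m "nat (n - m)"]
      by (cases "m > n") (simp_all add: lattice_def)
  qed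
qed

definition quad_at :: "data \<Rightarrow> (int \<Rightarrow> int \<Rightarrow> complex) \<Rightarrow> int \<Rightarrow> int \<Rightarrow> bool" where
  "quad_at q v n m \<longleftrightarrow> Q4 k sn (alpha n q) (beta m q) (v n m) (v (n + 1) m) (v n (m + 1)) (v (n + 1) (m + 1)) = 0"

lemma Q4_at_iff: "Q4_at k sn a b c v n m \<longleftrightarrow> quad_at (a, b, c, x, y) v n m"
  by (simp add: Q4_at_def quad_at_def alpha_def beta_def)

text \<open>\<open>Q4\<close> changes sign when the parameters and the two middle corners are
  exchanged. Writing \<open>- sn (a - b)\<close> in place of \<open>sn (b - a)\<close> keeps this
  purely algebraic.\<close>

lemma quad_at_swap:
  "quad_at q v n m \<longleftrightarrow>
    sn (beta m q) * (v n m * v n (m + 1) + v (n + 1) m * v (n + 1) (m + 1))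
    - sn (alpha n q) * (v n m * v (n + 1) m + v n (m + 1) * v (n + 1) (m + 1))
    - (- sn (alpha n q - beta m q)) * (v n (m + 1) * v (n + 1) m + v n m * v (n + 1) (m + 1)
      - k * sn (beta m q) * sn (alpha n q) * (1 + v n m * v n (m + 1) * v (n + 1) m * v (n + 1) (m + 1))) = 0"
  (is "_ \<longleftrightarrow> ?E = 0")
proof -
  have "Q4 k sn (alpha n q) (beta m q) (v n m) (v (n + 1) m) (v n (m + 1)) (v (n + 1) (m + 1)) = - ?E"
    by (simp add: Q4_def algebra_simps)
  then show ?thesis by (simp only: quad_at_def neg_equal_0_iff_equal)
qed

text \<open>The quads with \<open>m < n\<close> or \<open>n + 1 < m\<close> are exactly the row
  recursions. The constraint provides the second starting row on each side:
  \<open>v n (n + 2)\<close> repeats \<open>v (n + 1) (n + 1)\<close>, and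
  \<open>v (n + 1) n\<close> repeats \<open>v n (n + 1)\<close>.\<close>

lemma eq_lattice_iff:
  assumes "\<And>j n. upper_den j n q \<noteq> 0" "\<And>j n. lower_den j n q \<noteq> 0"
  shows "v = lattice q \<longleftrightarrow> (\<forall>n. v n n = r * diag q (2 * n - 1)) \<and> (\<forall>n. v n (n + 1) = r * diag q (2 * n)) \<and>
    diagonal_constraint v \<and> (\<forall>(n::int) m. m < n \<or> n + 1 < m \<longrightarrow> quad_at q v n m)"
proof -
  have upper: "(\<forall>j n. v n (n + int j + 1) = upper_rows q j n) \<longleftrightarrow>
    (\<forall>n. v n (n + 1) = r * diag q (2 * n)) \<and> (\<forall>n. v n (n + 2) = r * diag q (2 * n + 1)) \<and>
    (\<forall>j n. quad_at q v n (n + int j + 2))"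
    using quad_rows_unique[OF assms(1)[unfolded upper_den_def upper_rows_def], where R = "\<lambda>j n. v n (n + int j + 1)"]
    by (simp add: upper_rows_def quad_at_def Q4_def algebra_simps)
  have lower: "(\<forall>j n. v (n + int j) n = lower_rows q j n) \<longleftrightarrow>
    (\<forall>n. v n n = r * diag q (2 * n - 1)) \<and> (\<forall>n. v (n + 1) n = r * diag q (2 * n)) \<and>
    (\<forall>j n. quad_at q v (n + int j + 1) n)"
    using quad_rows_unique[OF assms(2)[unfolded lower_den_def lower_rows_def], where R = "\<lambda>j n. v (n + int j) n"]
    by (simp add: lower_rows_def quad_at_swap algebra_simps)
  have quads: "(\<forall>(n::int) m. m < n \<or> n + 1 < m \<longrightarrow> quad_at q v n m) \<longleftrightarrow>
    (\<forall>j n. quad_at q v n (n + int j + 2)) \<and> (\<forall>j n. quad_at q v (n + int j + 1) n)" (is "?L \<longleftrightarrow> ?R")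
  proof
    assume R: ?R
    show ?L
    proof (intro allI impI)
      fix n m :: int assume "m < n \<or> n + 1 < m"
      then consider "m = n + int (nat (m - n - 2)) + 2" | "n = m + int (nat (n - m - 1)) + 1" by linarith
      then show "quad_at q v n m" using R by cases metis+
    qed
  qed simp
  have constraint: "(\<forall>n. v n n = r * diag q (2 * n - 1)) \<and> (\<forall>n. v n (n + 1) = r * diag q (2 * n)) \<and> diagonal_constraint v
    \<longleftrightarrow> ((\<forall>n. v n (n + 1) = r * diag q (2 * n)) \<and> (\<forall>n. v n (n + 2) = r * diag q (2 * n + 1))) \<and>
    (\<forall>n. v n n = r * diag q (2 * n - 1)) \<and> (\<forall>n. v (n + 1) n = r * diag q (2 * n))" (is "?L \<longleftrightarrow> ?R")
  proof
    assume L: ?L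
    have "v n (n + 2) = r * diag q (2 * n + 1)" for n
    proof -
      have "v n (n + 2) = v (n + 1) (n + 1)"
        using L unfolding diagonal_constraint_def by (metis add_diff_cancel_right' add.assoc one_add_one)
      then show ?thesis using L by (simp add: add.commute)
    qed
    then show ?R using L unfolding diagonal_constraint_def by metis
  next
    assume R: ?R
    have "v n n = v (n - 1) (n + 1)" for n
      using R[THEN conjunct1, THEN conjunct2, rule_format, of "n - 1"] R by (simp add: add.commute)
    then show ?L using R by (simp add: diagonal_constraint_def)
  qed
  show ?thesis
    unfolding eq_lattice_iff_rows upper lower quads using constraint by argo
qed

text \<open>Collects what \<open>Q4_diagonal_iff\<close> requires on all quads of the two diagonals;
  only the parameters are involved.\<close>

definition admissible :: "data \<Rightarrow> bool" where
  "admissible q \<longleftrightarrow> (\<forall>n. alpha n q \<in> reg \<and> beta n q \<in> reg \<and> zeta n q \<in> reg \<and> zeta n q + zeta n q \<in> reg \<and>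
     gam n q \<in> reg \<and> sn (zeta n q) \<noteq> 0 \<and> 1 - k\<^sup>2 * sn (zeta n q) ^ 4 \<noteq> 0 \<and>
     1 - k\<^sup>2 * (sn (zeta n q))\<^sup>2 * (sn (gam n q))\<^sup>2 \<noteq> 0)"

lemma quad_at_even_iff:
  assumes "admissible q" "diagonal_constraint v" "identified r v u"
  shows "quad_at q v n n \<longleftrightarrow> ell_at q u (2 * n)"
proof -
  define z g where zg: "z = zeta (2 * n) q" "g = gam (2 * n) q"
  have ab: "alpha n q = g + z" "beta n q = g - z"
    by (simp_all add: zg alpha_def beta_def zeta_def gam_def field_simps split: prod.split)
  have v: "v n n = r * u (2 * n - 1)" "v n (n + 1) = r * u (2 * n)" "v (n + 1) n = r * u (2 * n)"
    "v (n + 1) (n + 1) = r * u (2 * n + 1)"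
    using assms(2)[unfolded diagonal_constraint_def, rule_format, of n]
      assms(3)[unfolded identified_def, rule_format, of n]
      assms(3)[unfolded identified_def, rule_format, of "n + 1"] r_nonzero
    by (simp_all add: ac_simps)
  have "alpha n q \<in> reg" "beta n q \<in> reg" "z \<in> reg" "z + z \<in> reg" "g \<in> reg" "sn z \<noteq> 0"
    "1 - k\<^sup>2 * sn z ^ 4 \<noteq> 0" "1 - k\<^sup>2 * (sn z)\<^sup>2 * (sn g)\<^sup>2 \<noteq> 0"
    using assms(1) unfolding admissible_def zg by auto
  then show ?thesis
    unfolding quad_at_def v ell_at_def coef_e_def coef_c_def coef_d_def zg[symmetric] ab
    by (intro Q4_diagonal_iff sqrt_modulus k_nonzero)
qed

text \<open>Here the lattice parameters are \<open>- g + z\<close> and \<open>- g - z\<close>, so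
  \<open>Q4_diagonal_iff\<close> is applied at \<open>- g\<close>. The resulting equation is even in
  \<open>g\<close>, as it contains \<open>g\<close> only through \<open>cn g * dn g\<close> and the
  squares of \<open>sn g\<close> and \<open>cn g\<close>.\<close>

lemma quad_at_odd_iff:
  assumes "admissible q" "diagonal_constraint v" "identified r v u"
  shows "quad_at q v n (n + 1) \<longleftrightarrow> ell_at q u (2 * n + 1)"
proof -
  define z g where zg: "z = zeta (2 * n + 1) q" "g = gam (2 * n + 1) q"
  have ab: "alpha n q = - g + z" "beta (n + 1) q = - g - z"
    by (simp_all add: zg alpha_def beta_def zeta_def gam_def field_simps split: prod.split)
  have eq: "n + 1 - 1 = n" "n + 1 + 1 = n + 2" "2 * (n + 1) - 1 = 2 * n + 1" "2 * (n + 1) = 2 * n + 2"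
    "2 * n + 1 - 1 = 2 * n" "2 * n + 1 + 1 = 2 * n + 2" by simp_all
  have v: "v n (n + 1) = r * u (2 * n)" "v (n + 1) (n + 1) = r * u (2 * n + 1)" "v n (n + 2) = r * u (2 * n + 1)"
    "v (n + 1) (n + 2) = r * u (2 * n + 2)"
    using assms(2)[unfolded diagonal_constraint_def, rule_format, of "n + 1", unfolded eq]
      assms(3)[unfolded identified_def, rule_format, of n]
      assms(3)[unfolded identified_def, rule_format, of "n + 1", unfolded eq] r_nonzero
    by (simp_all add: ac_simps)
  have *: "alpha n q \<in> reg" "beta (n + 1) q \<in> reg" "z \<in> reg" "z + z \<in> reg" "g \<in> reg" "sn z \<noteq> 0"
    "1 - k\<^sup>2 * sn z ^ 4 \<noteq> 0" "1 - k\<^sup>2 * (sn z)\<^sup>2 * (sn g)\<^sup>2 \<noteq> 0"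
    using assms(1) unfolding admissible_def zg by auto
  have even: "cn (- g) * dn (- g) = cn g * dn g" "(sn (- g))\<^sup>2 = (sn g)\<^sup>2" "(cn (- g))\<^sup>2 = (cn g)\<^sup>2"
    using *(5) by (simp_all add: cn_dn_minus sn_minus cn_minus_square)
  have "Q4 k sn (- g + z) (- g - z) (r * u (2 * n)) (r * u (2 * n + 1)) (r * u (2 * n + 1)) (r * u (2 * n + 2)) = 0 \<longleftrightarrow>
    cn (- g) * dn (- g) * (1 - k\<^sup>2 * sn z ^ 4) * u (2 * n + 1) * (u (2 * n + 2) + u (2 * n))
    - cn z * dn z * (1 - k\<^sup>2 * (sn z)\<^sup>2 * (sn (- g))\<^sup>2) * (u (2 * n + 2) * u (2 * n) + (u (2 * n + 1))\<^sup>2)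
    + ((cn z)\<^sup>2 - (cn (- g))\<^sup>2) * cn z * dn z * (1 + k\<^sup>2 * (u (2 * n + 1))\<^sup>2 * u (2 * n + 2) * u (2 * n)) = 0"
    using * even unfolding ab by (intro Q4_diagonal_iff sqrt_modulus k_nonzero) (simp_all add: even)
  then show ?thesis
    unfolding quad_at_def eq v ell_at_def coef_e_def coef_c_def coef_d_def zg[symmetric] ab even .
qed

lemma diagonal_quads_iff:
  assumes "admissible q" "diagonal_constraint v" "identified r v u"
  shows "(\<forall>n. quad_at q v n n \<and> quad_at q v n (n + 1)) \<longleftrightarrow> (\<forall>n. ell_at q u n)"
proof -
  have "(\<forall>n. ell_at q u n) \<longleftrightarrow> (\<forall>n. ell_at q u (2 * n) \<and> ell_at q u (2 * n + 1))"
    by (metis evenE oddE)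
  then show ?thesis
    using quad_at_even_iff[OF assms] quad_at_odd_iff[OF assms] by simp
qed

lemma identified_lattice: 
  assumes "\<forall>n. v n n = r * diag q (2 * n - 1)" "\<forall>n. v n (n + 1) = r * diag q (2 * n)"
  shows "identified r v (diag q)"
  using assms r_nonzero by (simp add: identified_def)

lemma identified_ex: "\<exists>u. identified r v u"
  by (rule exI[of _ "\<lambda>i. if even i then v (i div 2) (i div 2 + 1) / r else v ((i + 1) div 2) ((i + 1) div 2) / r"])
     (simp add: identified_def)

definition nondegenerate :: "data \<Rightarrow> bool" where
  "nondegenerate q \<longleftrightarrow> (\<forall>j. up_den j q \<noteq> 0) \<and> (\<forall>j. down_den j q \<noteq> 0) \<and>
     (\<forall>j n. upper_den j n q \<noteq> 0) \<and> (\<forall>j n. lower_den j n q \<noteq> 0)"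

lemma identified_diag:
  assumes q: "nondegenerate q" and v: "v = lattice q"
  shows "identified r v u \<longleftrightarrow> u = diag q"
proof
  have "identified r v (diag q)"
    using q v eq_lattice_iff[of q v] unfolding nondegenerate_def by (simp add: identified_lattice)
  then show "u = diag q \<Longrightarrow> identified r v u" by simp
  assume "identified r v u"
  with \<open>identified r v (diag q)\<close> have "u (2 * n) = diag q (2 * n) \<and> u (2 * n - 1) = diag q (2 * n - 1)" for n
    by (simp add: identified_def)
  then have "u i = diag q i" for i
  proof -
    have "\<exists>n. i = 2 * n \<or> i = 2 * n - 1" by presburger
    then show ?thesis
      using \<open>\<And>n. u (2 * n) = diag q (2 * n) \<and> u (2 * n - 1) = diag q (2 * n - 1)\<close> by metis
  qed
  then show "u = diag q" by blast
qed

text \<open>The difference equation fixes the values on the diagonals, and the remaining quads then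
  fix everything else.\<close>

lemma system_iff:
  assumes q: "admissible q" "nondegenerate q"
  shows "(\<forall>n m. quad_at q v n m) \<and> diagonal_constraint v \<and> v 0 0 = init_x q \<and> v 0 1 = init_y q \<longleftrightarrow> v = lattice q"
proof
  assume v: "(\<forall>n m. quad_at q v n m) \<and> diagonal_constraint v \<and> v 0 0 = init_x q \<and> v 0 1 = init_y q"
  obtain u where u: "identified r v u" using identified_ex by blast
  have "\<forall>n. ell_at q u n" using diagonal_quads_iff[OF q(1) _ u] v by blast
  moreover have "u (- 1) = init_x q / r" "u 0 = init_y q / r"
    using u[unfolded identified_def, rule_format, of 0] v by simp_all
  ultimately have "u = diag q" using eq_diag_iff q(2) by (simp add: nondegenerate_def)
  then have "(\<forall>n. v n n = r * diag q (2 * n - 1)) \<and> (\<forall>n. v n (n + 1) = r * diag q (2 * n))"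
    using u r_nonzero by (simp add: identified_def)
  then show "v = lattice q" using eq_lattice_iff q(2) v by (simp add: nondegenerate_def)
next
  assume v: "v = lattice q"
  then have *: "\<forall>n. v n n = r * diag q (2 * n - 1)" "\<forall>n. v n (n + 1) = r * diag q (2 * n)"
    "diagonal_constraint v" "\<And>n m. m < n \<or> n + 1 < m \<Longrightarrow> quad_at q v n m"
    using eq_lattice_iff[of q v] q(2) unfolding nondegenerate_def by blast+
  have ell: "\<forall>n. ell_at q (diag q) n" and init: "diag q (- 1) = init_x q / r" "diag q 0 = init_y q / r"
    using eq_diag_iff[of q "diag q"] q(2) by (simp_all add: nondegenerate_def)
  have "\<forall>n. quad_at q v n n \<and> quad_at q v n (n + 1)"
    using diagonal_quads_iff[OF q(1) *(3) identified_lattice[OF *(1,2)]] ell by blast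
  then have "quad_at q v n m" for n m
    using *(4)[of m n] by (metis linorder_neqE zless_add1_eq add1_zle_eq order_le_less)
  moreover have "v 0 0 = init_x q" "v 0 1 = init_y q"
    using *(1)[rule_format, of 0] *(2)[rule_format, of 0] init r_nonzero by simp_all
  ultimately show "(\<forall>n m. quad_at q v n m) \<and> diagonal_constraint v \<and> v 0 0 = init_x q \<and> v 0 1 = init_y q"
    using *(3) by blast
qed

lemma diag_iff:
  assumes q: "admissible q" "nondegenerate q"
  shows "(\<forall>n. ell_at q u n) \<and> u (- 1) = init_x q / r \<and> u 0 = init_y q / r \<longleftrightarrow>
    (\<exists>v. (\<forall>n m. quad_at q v n m) \<and> diagonal_constraint v \<and> v 0 0 = init_x q \<and> v 0 1 = init_y q \<and> identified r v u)"
proof -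
  have "(\<exists>v. (\<forall>n m. quad_at q v n m) \<and> diagonal_constraint v \<and> v 0 0 = init_x q \<and> v 0 1 = init_y q \<and> identified r v u)
    \<longleftrightarrow> (\<exists>v. v = lattice q \<and> identified r v u)"
    using system_iff[OF q] by blast
  also have "\<dots> \<longleftrightarrow> u = diag q" using identified_diag[OF q(2)] by blast
  also have "\<dots> \<longleftrightarrow> (\<forall>n. ell_at q u n) \<and> u (- 1) = init_x q / r \<and> u 0 = init_y q / r"
    using eq_diag_iff q(2) by (simp add: nondegenerate_def)
  finally show ?thesis by blast
qed

end

section \<open>Nondegeneracy\<close>

lemma regular_step_den:
  assumes "regular_at p e" "regular_at p c" "regular_at p d" "regular_at p u" "regular_at p w"
  shows "regular_at p (\<lambda>q. step_den k (e q) (c q) (d q) (u q) (w q))"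
  unfolding step_den_def by (intro regular_at_intros assms)

lemma regular_step_sol:
  assumes "regular_at p e" "regular_at p c" "regular_at p d" "regular_at p u" "regular_at p w"
    and "step_den k (e p) (c p) (d p) (u p) (w p) \<noteq> 0"
  shows "regular_at p (\<lambda>q. step_sol k (e q) (c q) (d q) (u q) (w q))"
  unfolding step_sol_def by (intro regular_at_intros regular_step_den assms)

lemma regular_quad_den:
  assumes "regular_at p A" "regular_at p B" "regular_at p C" "regular_at p w" "regular_at p x" "regular_at p z"
  shows "regular_at p (\<lambda>q. quad_den k (A q) (B q) (C q) (w q) (x q) (z q))"
  unfolding quad_den_def by (intro regular_at_intros assms)

lemma regular_quad_sol:
  assumes "regular_at p A" "regular_at p B" "regular_at p C" "regular_at p w" "regular_at p x" "regular_at p z"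
    and "quad_den k (A p) (B p) (C p) (w p) (x p) (z p) \<noteq> 0"
  shows "regular_at p (\<lambda>q. quad_sol k (A q) (B q) (C q) (w q) (x q) (z q))"
  unfolding quad_sol_def by (intro regular_at_intros regular_quad_den assms)

text \<open>The factor is a Moebius function of \<open>u^2\<close> with the values \<open>s\<close>
  at 0 and \<open>1 / (s * k^2)\<close> at infinity, both finite and nonzero.\<close>

lemma filterlim_at_0_or_infinity_factor:
  fixes u :: "'a \<Rightarrow> complex" and s k :: complex
  assumes "s \<noteq> 0" "k \<noteq> 0"
    and u: "filterlim u (at 0) F \<or> filterlim u at_infinity F"
  shows "\<exists>L. L \<noteq> 0 \<and> ((\<lambda>t. ((u t)\<^sup>2 - s) / (s * k\<^sup>2 * (u t)\<^sup>2 - 1)) \<longlongrightarrow> L) F"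
    and "\<forall>\<^sub>F t in F. s * k\<^sup>2 * (u t)\<^sup>2 - 1 \<noteq> 0"
proof -
  have "(\<exists>L. L \<noteq> 0 \<and> ((\<lambda>t. ((u t)\<^sup>2 - s) / (s * k\<^sup>2 * (u t)\<^sup>2 - 1)) \<longlongrightarrow> L) F) \<and>
    (\<forall>\<^sub>F t in F. s * k\<^sup>2 * (u t)\<^sup>2 - 1 \<noteq> 0)"
    using u
  proof
    assume "filterlim u (at 0) F"
    then have u0: "(u \<longlongrightarrow> 0) F" by (simp add: filterlim_at)
    have den: "((\<lambda>t. s * k\<^sup>2 * (u t)\<^sup>2 - 1) \<longlongrightarrow> - 1) F"
      by (rule tendsto_eq_intros u0 refl | simp)+
    have "((\<lambda>t. ((u t)\<^sup>2 - s) / (s * k\<^sup>2 * (u t)\<^sup>2 - 1)) \<longlongrightarrow> s) F"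
      by (rule tendsto_eq_intros u0 refl | simp)+
    moreover have "\<forall>\<^sub>F t in F. s * k\<^sup>2 * (u t)\<^sup>2 - 1 \<noteq> 0"
      by (rule tendsto_imp_eventually_ne[OF den]) simp
    ultimately show ?thesis using assms(1) by blast
  next
    assume inf: "filterlim u at_infinity F"
    define v where "v t = inverse (u t)" for t
    have v: "(v \<longlongrightarrow> 0) F"
      using filterlim_compose[OF tendsto_inverse_0 inf] by (simp add: v_def[abs_def])
    have ne: "\<forall>\<^sub>F t in F. u t \<noteq> 0" by (rule filterlim_at_infinity_imp_eventually_ne[OF inf])
    have den: "((\<lambda>t. s * k\<^sup>2 - (v t)\<^sup>2) \<longlongrightarrow> s * k\<^sup>2) F"
      by (rule tendsto_eq_intros v refl | simp)+
    have "\<forall>\<^sub>F t in F. s * k\<^sup>2 - (v t)\<^sup>2 \<noteq> 0"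
      by (rule tendsto_imp_eventually_ne[OF den]) (use assms in simp)
    with ne have ev: "\<forall>\<^sub>F t in F. s * k\<^sup>2 * (u t)\<^sup>2 - 1 \<noteq> 0"
      by eventually_elim (auto simp: v_def field_simps power_inverse)
    have "((\<lambda>t. (1 - s * (v t)\<^sup>2) / (s * k\<^sup>2 - (v t)\<^sup>2)) \<longlongrightarrow> 1 / (s * k\<^sup>2)) F"
      by (rule tendsto_eq_intros v den refl | simp add: assms)+
    moreover have "\<forall>\<^sub>F t in F. (1 - s * (v t)\<^sup>2) / (s * k\<^sup>2 - (v t)\<^sup>2) = ((u t)\<^sup>2 - s) / (s * k\<^sup>2 * (u t)\<^sup>2 - 1)"
      using ne
    proof eventually_elim
      fix t assume t: "u t \<noteq> 0"
      have "(1 - s * (v t)\<^sup>2) / (s * k\<^sup>2 - (v t)\<^sup>2) = ((u t)\<^sup>2 * (1 - s * (v t)\<^sup>2)) / ((u t)\<^sup>2 * (s * k\<^sup>2 - (v t)\<^sup>2))"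
        using t by simp
      also have "(u t)\<^sup>2 * (1 - s * (v t)\<^sup>2) = (u t)\<^sup>2 - s"
        using t by (simp add: v_def field_simps)
      also have "(u t)\<^sup>2 * (s * k\<^sup>2 - (v t)\<^sup>2) = s * k\<^sup>2 * (u t)\<^sup>2 - 1"
        using t by (simp add: v_def field_simps)
      finally show "(1 - s * (v t)\<^sup>2) / (s * k\<^sup>2 - (v t)\<^sup>2) = ((u t)\<^sup>2 - s) / (s * k\<^sup>2 * (u t)\<^sup>2 - 1)" .
    qed
    ultimately have "((\<lambda>t. ((u t)\<^sup>2 - s) / (s * k\<^sup>2 * (u t)\<^sup>2 - 1)) \<longlongrightarrow> 1 / (s * k\<^sup>2)) F"
      using tendsto_cong by fast
    then show ?thesis using ev assms by (intro conjI exI[of _ "1 / (s * k\<^sup>2)"]) auto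
  qed
  then show "\<exists>L. L \<noteq> 0 \<and> ((\<lambda>t. ((u t)\<^sup>2 - s) / (s * k\<^sup>2 * (u t)\<^sup>2 - 1)) \<longlongrightarrow> L) F"
    "\<forall>\<^sub>F t in F. s * k\<^sup>2 * (u t)\<^sup>2 - 1 \<noteq> 0" by blast+
qed

section \<open>The autonomous recursion for small initial values\<close>

context
  fixes k s :: complex
  assumes k: "k \<noteq> 0" and s: "s \<noteq> 0"
begin

abbreviation "auto_seq t \<equiv> step_seq k (\<lambda>_. 0) (\<lambda>_. 1) (\<lambda>_. s) t t"

lemma auto_step_eq: "step_sol k 0 1 s u w = ((u\<^sup>2 - s) / (s * k\<^sup>2 * u\<^sup>2 - 1)) / w"
  "step_den k 0 1 s u w = (s * k\<^sup>2 * u\<^sup>2 - 1) * w"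
  by (simp_all add: step_sol_def step_den_def algebra_simps divide_simps)

text \<open>The filter \<open>at 0\<close>, stronger than convergence to 0, records that values are
  eventually nonzero, as the next division by \<open>w\<close> requires.\<close>

lemma auto_step_limit:
  fixes u w :: "complex \<Rightarrow> complex"
  assumes u: "filterlim u (at 0) F \<or> filterlim u at_infinity F"
  shows "filterlim w (at 0) F \<Longrightarrow> filterlim (\<lambda>t. step_sol k 0 1 s (u t) (w t)) at_infinity F"
    and "filterlim w at_infinity F \<Longrightarrow> filterlim (\<lambda>t. step_sol k 0 1 s (u t) (w t)) (at 0) F"
proof -
  obtain L where L: "L \<noteq> 0" "((\<lambda>t. ((u t)\<^sup>2 - s) / (s * k\<^sup>2 * (u t)\<^sup>2 - 1)) \<longlongrightarrow> L) F"
    using filterlim_at_0_or_infinity_factor(1)[OF s k u] by blast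
  show "filterlim (\<lambda>t. step_sol k 0 1 s (u t) (w t)) at_infinity F" if "filterlim w (at 0) F"
    unfolding auto_step_eq by (rule filterlim_divide_at_infinity[OF L(2) that L(1)])
  show "filterlim (\<lambda>t. step_sol k 0 1 s (u t) (w t)) (at 0) F" if w: "filterlim w at_infinity F"
    unfolding auto_step_eq
  proof (rule filterlim_atI)
    show "((\<lambda>t. ((u t)\<^sup>2 - s) / (s * k\<^sup>2 * (u t)\<^sup>2 - 1) / w t) \<longlongrightarrow> 0) F"
      by (rule tendsto_divide_0[OF L(2) w])
    show "\<forall>\<^sub>F t in F. ((u t)\<^sup>2 - s) / (s * k\<^sup>2 * (u t)\<^sup>2 - 1) / w t \<noteq> 0"
      using tendsto_imp_eventually_ne[OF L(2,1)] filterlim_at_infinity_imp_eventually_ne[OF w, of 0]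
      by eventually_elim simp
  qed
qed

text \<open>Since the factor multiplying \<open>1 / w\<close> tends to a nonzero number whether \<open>u\<close> tends to 0 or to
  infinity, the terms \<open>j\<close> and \<open>j + 2\<close> have opposite limits.\<close>
lemma auto_seq_limit:
  "filterlim (\<lambda>t. auto_seq t j) (at 0) (at 0) \<or> filterlim (\<lambda>t. auto_seq t j) at_infinity (at 0)"
proof (induction j rule: induct_nat_012)
  case (ge2 j)
  then show ?case unfolding step_seq.simps using auto_step_limit[OF ge2(2)] by blast
qed (simp_all add: filterlim_ident)

lemma auto_seq_den: "\<forall>\<^sub>F t in at 0. step_den k 0 1 s (auto_seq t (Suc j)) (auto_seq t j) \<noteq> 0"
proof -
  have "\<forall>\<^sub>F t in at 0. auto_seq t j \<noteq> 0"
    using auto_seq_limit[of j] filterlim_at_infinity_imp_eventually_ne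
    by (auto simp: filterlim_at)
  with filterlim_at_0_or_infinity_factor(2)[OF s k auto_seq_limit[of "Suc j"]]
  show ?thesis by eventually_elim (simp add: auto_step_eq)
qed

lemma auto_seq_distinct: "\<forall>\<^sub>F t in at 0. auto_seq t j \<noteq> auto_seq t (j + 2)"
proof -
  have *: "\<forall>\<^sub>F t in F. f t \<noteq> g t" if f: "filterlim f (at 0) F" and g: "filterlim g at_infinity F"
    for f g :: "complex \<Rightarrow> complex" and F
  proof -
    have "(f \<longlongrightarrow> 0) F" using f by (simp add: filterlim_at)
    then have "\<forall>\<^sub>F t in F. norm (f t) < 1" using tendstoD[of f 0 F 1] by simp
    moreover have "\<forall>\<^sub>F t in F. norm (g t) \<ge> 1"
      using g filterlim_at_infinity[of 0 g F] by simp
    ultimately show ?thesis by eventually_elim auto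
  qed
  show ?thesis
    using auto_seq_limit[of j]
  proof
    assume z: "filterlim (\<lambda>t. auto_seq t j) (at 0) (at 0)"
    then show ?thesis
      using auto_step_limit(1)[OF auto_seq_limit[of "Suc j"] z] *[OF z] by simp
  next
    assume z: "filterlim (\<lambda>t. auto_seq t j) at_infinity (at 0)"
    have "\<forall>\<^sub>F t in at 0. auto_seq t (j + 2) \<noteq> auto_seq t j"
      using auto_step_limit(2)[OF auto_seq_limit[of "Suc j"] z] *[OF _ z] by simp
    then show ?thesis by eventually_elim simp
  qed
qed

end

context diagonal_Q4
begin

section \<open>Evaluation at the reference point\<close>

lemma regular_affine:
  assumes "\<And>a b c x y. L (a, b, c, x, y) = l * a + m * b + n * c" and "L p \<in> reg"
  shows "regular_at p (\<lambda>q. sn (L q))" "regular_at p (\<lambda>q. cn (L q))" "regular_at p (\<lambda>q. dn (L q))"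
  using nicely_meromorphic reg_not_pole[OF assms(2)]
  by (intro regular_at_meromorphic_affine[OF _ assms(1)]; simp)+

lemma affine_forms:
  "alpha n (a, b, c, x, y) = 1 * a + 0 * b + of_int n * c"
  "beta n (a, b, c, x, y) = 0 * a + 1 * b + (- of_int n) * c"
  "alpha n (a, b, c, x, y) - beta m (a, b, c, x, y) = 1 * a + (- 1) * b + of_int (n + m) * c"
  "zeta n (a, b, c, x, y) = (1 / 2) * a + (- 1 / 2) * b + (of_int n / 2) * c"
  "zeta n (a, b, c, x, y) + zeta n (a, b, c, x, y) = 1 * a + (- 1) * b + of_int n * c"
  "even n \<Longrightarrow> gam n (a, b, c, x, y) = (1 / 2) * a + (1 / 2) * b + 0 * c"
  "odd n \<Longrightarrow> gam n (a, b, c, x, y) = (- 1 / 2) * a + (- 1 / 2) * b + (1 / 2) * c"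
  by (simp_all add: alpha_def beta_def zeta_def gam_def field_simps)

lemma admissible_cong: "admissible (a, b, c, x, y) = admissible (a, b, c, 0, 0)"
  by (simp add: admissible_def alpha_def beta_def zeta_def gam_def)

text \<open>At \<open>\<alpha>\<^sub>0 = \<beta>\<^sub>0 = K\<close>, \<open>\<phi> = 0\<close> with \<open>cn K * dn K = 0\<close> the quad equation degenerates to
  \<open>(w - z) * (x - y) = 0\<close> and the diagonal recursion to \<open>u\<^sub>n\<^sub>+\<^sub>1 u\<^sub>n\<^sub>-\<^sub>1 = (s - u\<^sub>n\<^sup>2) / (1 - s k\<^sup>2 u\<^sub>n\<^sup>2)\<close>,
  where \<open>s = sn\<^sup>2 K\<close>.\<close>
context
  fixes K :: complex
  assumes K: "K \<in> reg" "cn K * dn K = 0"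
begin

definition pt :: "complex \<Rightarrow> data" where "pt t = (K, K, 0, r * t, r * t)"

definition s :: complex where "s = (sn K)\<^sup>2"

lemma sn_K: "sn K \<noteq> 0" and s_nonzero: "s \<noteq> 0"
proof -
  show "sn K \<noteq> 0" using sn_cn[OF K(1)] sn_dn[OF K(1)] K(2) by auto
  then show "s \<noteq> 0" by (simp add: s_def)
qed

lemma forms_at_pt: "alpha n (pt t) = K" "beta n (pt t) = K" "zeta n (pt t) = 0"
  "gam n (pt t) = (if even n then K else - K)" "init_x (pt t) = r * t" "init_y (pt t) = r * t"
  by (simp_all add: pt_def alpha_def beta_def zeta_def gam_def init_x_def init_y_def)

lemma regular_forms:
  "regular_at (pt t) (\<lambda>q. sn (alpha n q))" "regular_at (pt t) (\<lambda>q. sn (beta n q))"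
  "regular_at (pt t) (\<lambda>q. sn (alpha n q - beta m q))"
  "regular_at (pt t) (\<lambda>q. sn (zeta n q))" "regular_at (pt t) (\<lambda>q. cn (zeta n q))" "regular_at (pt t) (\<lambda>q. dn (zeta n q))"
  using regular_affine[OF affine_forms(1), where p = "pt t"] regular_affine[OF affine_forms(2), where p = "pt t"]
    regular_affine[OF affine_forms(3), where p = "pt t"] regular_affine[OF affine_forms(4), where p = "pt t"] K
  by (simp_all add: forms_at_pt)

lemma regular_gam:
  "regular_at (pt t) (\<lambda>q. sn (gam n q))" "regular_at (pt t) (\<lambda>q. cn (gam n q))" "regular_at (pt t) (\<lambda>q. dn (gam n q))"
proof -
  have gam: "gam n (pt t) \<in> reg" using K by (simp add: forms_at_pt)
  show "regular_at (pt t) (\<lambda>q. sn (gam n q))" "regular_at (pt t) (\<lambda>q. cn (gam n q))" "regular_at (pt t) (\<lambda>q. dn (gam n q))"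
    by (cases "even n", rule regular_affine[OF affine_forms(6) gam], assumption, rule regular_affine[OF affine_forms(7) gam], assumption)+
qed

lemma regular_coef:
  "regular_at (pt t) (coef_e n)" "regular_at (pt t) (coef_c n)" "regular_at (pt t) (coef_d n)"
  unfolding coef_e_def[abs_def] coef_c_def[abs_def] coef_d_def[abs_def]
  by (intro regular_at_intros regular_forms regular_gam)+

text \<open>At \<open>zeta = 0\<close> one has \<open>sn = 0\<close> and \<open>cn = dn = 1\<close>.
  At \<open>gam\<close>, which is \<open>K\<close> or \<open>- K\<close> according to parity,
  evenness gives \<open>cn * dn = 0\<close> and \<open>cn^2 = 1 - s\<close>.\<close>

lemma coef_at_pt: "coef_e n (pt t) = 0" "coef_c n (pt t) = 1" "coef_d n (pt t) = s"
proof -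
  have "cn (- K) * dn (- K) = 0" "(cn (- K))\<^sup>2 = 1 - s" "(cn K)\<^sup>2 = 1 - s"
    using K by (simp_all add: cn_dn_minus cn_minus_square sn_cn[OF K(1)] s_def)
  then show "coef_e n (pt t) = 0" "coef_c n (pt t) = 1" "coef_d n (pt t) = s"
    using K by (simp_all add: coef_e_def coef_c_def coef_d_def forms_at_pt)
qed

lemma regular_init:
  "regular_at (pt t) (\<lambda>q. init_x q / r)" "regular_at (pt t) (\<lambda>q. init_y q / r)"
  unfolding init_x_def init_y_def using r_nonzero by (auto intro!: regular_at_divide regular_at_x regular_at_y regular_at_const)

abbreviation "G t j \<equiv> step_seq k (\<lambda>_. 0) (\<lambda>_. 1) (\<lambda>_. s) t t j"

lemma up_at_pt: "up (pt t) j = G t j" and down_at_pt: "down (pt t) j = G t j"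
  using r_nonzero by (simp_all add: up_def down_def coef_at_pt forms_at_pt)

lemma den_at_pt:
  "up_den j (pt t) = step_den k 0 1 s (G t (Suc j)) (G t j)"
  "down_den j (pt t) = step_den k 0 1 s (G t (Suc j)) (G t j)"
  by (simp_all add: up_den_def down_den_def coef_at_pt up_at_pt down_at_pt)

text \<open>How small \<open>t\<close> must be depends on \<open>j\<close>, since each step adds a
  denominator that is nonzero only for \<open>t\<close> near 0.\<close>

lemma regular_up: "\<forall>\<^sub>F t in at 0. regular_at (pt t) (\<lambda>q. up q j)"
proof (induction j rule: induct_nat_012)
  case (ge2 j)
  from ge2 auto_seq_den[OF k_nonzero s_nonzero, of j] show ?case
  proof eventually_elim
    case (elim t)
    then show ?case unfolding up_def step_seq.simps unfolding up_def[symmetric]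
      by (intro regular_step_sol regular_coef) (simp_all add: coef_at_pt up_at_pt)
  qed
qed (simp_all add: up_0_1 regular_init)

lemma regular_down: "\<forall>\<^sub>F t in at 0. regular_at (pt t) (\<lambda>q. down q j)"
proof (induction j rule: induct_nat_012)
  case (ge2 j)
  from ge2 auto_seq_den[OF k_nonzero s_nonzero, of j] show ?case
  proof eventually_elim
    case (elim t)
    then show ?case unfolding down_def step_seq.simps unfolding down_def[symmetric]
      by (intro regular_step_sol regular_coef) (simp_all add: coef_at_pt down_at_pt)
  qed
qed (simp_all add: down_0_1 regular_init)

lemma regular_up_den: "\<forall>\<^sub>F t in at 0. regular_at (pt t) (up_den j) \<and> up_den j (pt t) \<noteq> 0"
  using regular_up[of j] regular_up[of "Suc j"] auto_seq_den[OF k_nonzero s_nonzero, of j]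
proof eventually_elim
  case (elim t)
  then show ?case unfolding den_at_pt unfolding up_den_def[abs_def]
    by (intro conjI regular_step_den regular_coef)
qed

lemma regular_down_den: "\<forall>\<^sub>F t in at 0. regular_at (pt t) (down_den j) \<and> down_den j (pt t) \<noteq> 0"
  using regular_down[of j] regular_down[of "Suc j"] auto_seq_den[OF k_nonzero s_nonzero, of j]
proof eventually_elim
  case (elim t)
  then show ?case unfolding den_at_pt unfolding down_den_def[abs_def]
    by (intro conjI regular_step_den regular_coef)
qed

lemma regular_diag: "\<forall>\<^sub>F t in at 0. regular_at (pt t) (\<lambda>q. diag q i)"
  by (cases "i \<ge> - 1") (simp_all add: diag_def regular_up regular_down)

lemma diag_distinct: "\<forall>\<^sub>F t in at 0. diag (pt t) i \<noteq> diag (pt t) (i + 2)"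
proof (cases "i \<ge> - 1")
  case True
  then have "nat (i + 2 + 1) = nat (i + 1) + 2" by simp
  then show ?thesis
    using True auto_seq_distinct[OF k_nonzero s_nonzero, of "nat (i + 1)"]
    by (simp add: diag_def up_at_pt down_at_pt)
next
  case False
  \<comment> \<open>With this \<open>j\<close> the indices \<open>i\<close> and \<open>i + 2\<close>
    belong to the terms \<open>j + 2\<close> and \<open>j\<close> of the backward sequence. The
    index \<open>i + 2\<close> may be -1 or 0, where \<open>diag\<close> switches to
    \<open>up\<close>.\<close>
  define j where "j = nat (- i - 2)"
  have i: "i = - int j - 2" using False by (simp add: j_def)
  have "diag (pt t) (i + 2) = G t j" for t
  proof -
    consider "j = 0" | "j = 1" | "- int j < - 1" by linarith
    then show ?thesis unfolding i by cases (use r_nonzero in \<open>simp_all add: diag_def up_0_1 forms_at_pt down_at_pt\<close>)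
  qed
  moreover have "diag (pt t) i = G t (j + 2)" for t
  proof -
    have "nat (- i) = j + 2" using i by simp
    then show ?thesis using False by (simp add: diag_def down_at_pt)
  qed
  moreover have "\<forall>\<^sub>F t in at 0. G t (j + 2) \<noteq> G t j"
    using auto_seq_distinct[OF k_nonzero s_nonzero, of j] by eventually_elim simp
  ultimately show ?thesis by simp
qed

text \<open>The quad polynomial becomes \<open>sn K * (w - z) * (x - y)\<close>, so the new corner
  copies the opposite one.\<close>

lemma degenerate_quad:
  assumes "w \<noteq> z"
  shows "quad_den k (sn K) (sn K) 0 w x z \<noteq> 0" "quad_sol k (sn K) (sn K) 0 w x z = x"
proof -
  have "quad_den k (sn K) (sn K) 0 w x z = sn K * (z - w)" by (simp add: quad_den_def algebra_simps)
  moreover have "- (sn K * w * x - sn K * x * z - 0 * (w * z - k * sn K * sn K)) = x * (sn K * (z - w))"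
    by (simp add: algebra_simps)
  ultimately show "quad_den k (sn K) (sn K) 0 w x z \<noteq> 0" "quad_sol k (sn K) (sn K) 0 w x z = x"
    using assms sn_K unfolding quad_sol_def by simp_all
qed

text \<open>Row \<open>j + 2\<close> at \<open>n\<close> copies row \<open>j\<close> at
  \<open>n + 1\<close>, and \<open>2 * (n + 1) + j = 2 * n + (j + 2)\<close>; so a value depends on
  \<open>2 * n + j\<close> alone. The corners that must differ have diagonal indices at distance 2,
  which is \<open>diag_distinct\<close>. The shift \<open>c\<close> is 0 for the upper and -1 for
  the lower rows.\<close>

lemma rows_at_pt:
  fixes c :: int
  assumes A: "\<And>j n t. regular_at (pt t) (\<lambda>q. A q j n)" "\<And>j n t. A (pt t) j n = sn K"
    and B: "\<And>j n t. regular_at (pt t) (\<lambda>q. B q j n)" "\<And>j n t. B (pt t) j n = sn K"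
    and C: "\<And>j n t. regular_at (pt t) (\<lambda>q. C q j n)" "\<And>j n t. C (pt t) j n = 0"
  defines "R \<equiv> \<lambda>q. quad_rows k (A q) (B q) (C q) (\<lambda>n. r * diag q (2 * n + c)) (\<lambda>n. r * diag q (2 * n + 1 + c))"
  shows "\<forall>\<^sub>F t in at 0. regular_at (pt t) (\<lambda>q. R q j n) \<and> R (pt t) j n = r * diag (pt t) (2 * n + int j + c)" (is "?P j n")
    and "\<forall>\<^sub>F t in at 0. regular_at (pt t) (\<lambda>q. quad_den k (A q j n) (B q j n) (C q j n) (R q (Suc j) n) (R q j (n + 1)) (R q (Suc j) (n + 1)))
        \<and> quad_den k (A (pt t) j n) (B (pt t) j n) (C (pt t) j n) (R (pt t) (Suc j) n) (R (pt t) j (n + 1)) (R (pt t) (Suc j) (n + 1)) \<noteq> 0"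
proof -
  have distinct: "r * diag q (2 * n + int (Suc j) + c) \<noteq> r * diag q (2 * (n + 1) + int (Suc j) + c)"
    if "diag q (2 * n + int (Suc j) + c) \<noteq> diag q (2 * n + int (Suc j) + c + 2)" for q n j
    using that r_nonzero by (simp add: algebra_simps)
  have P: "?P j n" for j n
  proof (induction j arbitrary: n rule: induct_nat_012)
    case 0
    show ?case using regular_diag[of "2 * n + c"]
      by eventually_elim (auto simp: R_def intro!: regular_at_intros)
  next
    case 1
    show ?case using regular_diag[of "2 * n + 1 + c"]
      by eventually_elim (auto simp: R_def intro!: regular_at_intros)
  next
    case (ge2 j)
    from ge2(2)[of n] ge2(1)[of "n + 1"] ge2(2)[of "n + 1"] diag_distinct[of "2 * n + int (Suc j) + c"]
    show ?case
    proof eventually_elim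
      case (elim t)
      have ne: "R (pt t) (Suc j) n \<noteq> R (pt t) (Suc j) (n + 1)"
        using elim(1,3) distinct[OF elim(4)] by simp
      have R: "R q (Suc (Suc j)) n = quad_sol k (A q j n) (B q j n) (C q j n) (R q (Suc j) n) (R q j (n + 1)) (R q (Suc j) (n + 1))" for q
        by (simp add: R_def)
      show ?case
        unfolding R using elim degenerate_quad[OF ne]
        by (intro conjI regular_quad_sol A B C) (simp_all add: A B C algebra_simps)
    qed
  qed
  then show "?P j n" .
  from P[of "Suc j" n] P[of j "n + 1"] P[of "Suc j" "n + 1"] diag_distinct[of "2 * n + int (Suc j) + c"]
  show "\<forall>\<^sub>F t in at 0. regular_at (pt t) (\<lambda>q. quad_den k (A q j n) (B q j n) (C q j n) (R q (Suc j) n) (R q j (n + 1)) (R q (Suc j) (n + 1)))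
        \<and> quad_den k (A (pt t) j n) (B (pt t) j n) (C (pt t) j n) (R (pt t) (Suc j) n) (R (pt t) j (n + 1)) (R (pt t) (Suc j) (n + 1)) \<noteq> 0"
  proof eventually_elim
    case (elim t)
    have ne: "R (pt t) (Suc j) n \<noteq> R (pt t) (Suc j) (n + 1)"
      using elim(1,3) distinct[OF elim(4)] by simp
    show ?case
      using elim degenerate_quad[OF ne] by (intro conjI regular_quad_den A B C) (simp_all add: A B C)
  qed
qed

section \<open>Genericity of nondegeneracy and admissibility\<close>

lemma regular_upper_den: "\<forall>\<^sub>F t in at 0. regular_at (pt t) (upper_den j n) \<and> upper_den j n (pt t) \<noteq> 0"
  unfolding upper_den_def[abs_def] upper_rows_def
  using rows_at_pt(2)[where A = "\<lambda>q j n. sn (alpha n q)" and B = "\<lambda>q j n. sn (beta (n + int j + 2) q)"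
    and C = "\<lambda>q j n. sn (alpha n q - beta (n + int j + 2) q)" and c = 0]
  by (simp add: regular_forms forms_at_pt)

lemma regular_lower_den: "\<forall>\<^sub>F t in at 0. regular_at (pt t) (lower_den j n) \<and> lower_den j n (pt t) \<noteq> 0"
  unfolding lower_den_def[abs_def] lower_rows_def
  using rows_at_pt(2)[where A = "\<lambda>q j n. sn (beta n q)" and B = "\<lambda>q j n. sn (alpha (n + int j + 1) q)"
    and C = "\<lambda>q j n. - sn (alpha (n + int j + 1) q - beta n q)" and c = "- 1"]
  by (simp add: regular_forms forms_at_pt regular_at_minus)

lemma generic_nonzero:
  assumes "\<forall>\<^sub>F t in at 0. regular_at (pt t) f \<and> f (pt t) \<noteq> 0"
  shows "generic_triple (\<lambda>a b c. generic_pair (\<lambda>x y. f (a, b, c, x, y) \<noteq> 0))"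
proof -
  obtain t where "regular_at (pt t) f" "f (pt t) \<noteq> 0"
    using eventually_happens'[OF at_neq_bot assms] by blast
  from regular_at_generic_nonzero[OF this[unfolded pt_def]] show ?thesis
    by (rule generic_triple_mono) blast
qed

lemma generic_nondegenerate: "generic_triple (\<lambda>a b c. generic_pair (\<lambda>x y. nondegenerate (a, b, c, x, y)))"
proof -
  have *: "generic_triple (\<lambda>a b c. \<forall>i. generic_pair (\<lambda>x y. f i (a, b, c, x, y) \<noteq> 0))"
    if "\<And>i. \<forall>\<^sub>F t in at 0. regular_at (pt t) (f i) \<and> f i (pt t) \<noteq> 0"
    for f :: "'i :: countable \<Rightarrow> data \<Rightarrow> complex"
    by (rule generic_triple_all, rule generic_nonzero, rule that)
  \<comment> \<open>One countable sum type indexes all four families of denominators.\<close>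
  have "generic_triple (\<lambda>a b c. \<forall>i. generic_pair (\<lambda>x y. (case i of Inl (Inl j) \<Rightarrow> up_den j | Inl (Inr j) \<Rightarrow> down_den j
      | Inr (Inl (j, n)) \<Rightarrow> upper_den j n | Inr (Inr (j, n)) \<Rightarrow> lower_den j n) (a, b, c, x, y) \<noteq> 0))"
    by (rule *) (auto split: sum.split intro: regular_up_den regular_down_den regular_upper_den regular_lower_den)
  then show ?thesis
  proof (rule generic_triple_mono)
    fix a b c
    assume "\<forall>i. generic_pair (\<lambda>x y. (case i of Inl (Inl j) \<Rightarrow> up_den j | Inl (Inr j) \<Rightarrow> down_den j
      | Inr (Inl (j, n)) \<Rightarrow> upper_den j n | Inr (Inr (j, n)) \<Rightarrow> lower_den j n) (a, b, c, x, y) \<noteq> 0)"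
    then have "generic_pair (\<lambda>x y. \<forall>i. (case i of Inl (Inl j) \<Rightarrow> up_den j | Inl (Inr j) \<Rightarrow> down_den j
      | Inr (Inl (j, n)) \<Rightarrow> upper_den j n | Inr (Inr (j, n)) \<Rightarrow> lower_den j n) (a, b, c, x, y) \<noteq> 0)"
      by (intro generic_pair_all) blast
    then show "generic_pair (\<lambda>x y. nondegenerate (a, b, c, x, y))"
    proof (rule generic_pair_mono)
      fix x y
      assume *: "\<forall>i. (case i of Inl (Inl j) \<Rightarrow> up_den j | Inl (Inr j) \<Rightarrow> down_den j
      | Inr (Inl (j, n)) \<Rightarrow> upper_den j n | Inr (Inr (j, n)) \<Rightarrow> lower_den j n) (a, b, c, x, y) \<noteq> 0"
      show "nondegenerate (a, b, c, x, y)"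
        unfolding nondegenerate_def
        using *[rule_format, of "Inl (Inl _)"] *[rule_format, of "Inl (Inr _)"]
          *[rule_format, of "Inr (Inl (_, _))"] *[rule_format, of "Inr (Inr (_, _))"] by simp
    qed
  qed
qed

lemma generic_admissible: "generic_triple (\<lambda>a b c. admissible (a, b, c, 0, 0))"
proof -
  have 1: "generic_triple (\<lambda>a b c. L (a, b, c, 0, 0) \<notin> S)"
    if "countable S" "l \<noteq> 0 \<or> m \<noteq> 0 \<or> n \<noteq> 0" "\<And>a b c. L (a, b, c, 0, 0) = l * a + m * b + n * c"
    for L :: "data \<Rightarrow> complex" and l m n S
    using generic_triple_affine[OF that(1,2)] by (simp add: that(3))
  \<comment> \<open>All conditions on \<open>zeta n\<close> by itself amount to avoiding this
    countable set.\<close>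
  define Z where "Z = - reg \<union> {z \<in> reg. sn z = 0} \<union> {z \<in> reg. k\<^sup>2 * sn z ^ 4 = 1}"
  have Z: "countable Z"
    unfolding Z_def using countable_not_reg countable_sn_zeros countable_sn_power[of 4] by simp
  have gam: "generic_triple (\<lambda>a b c. gam n (a, b, c, 0, 0) \<notin> - reg)" for n
    by (cases "even n") (rule 1[OF countable_not_reg _ affine_forms(6)] 1[OF countable_not_reg _ affine_forms(7)]; simp)+
  \<comment> \<open>Two different linear forms occur together here, so avoiding countably many
    values of one form is not enough. At the reference point \<open>sn (zeta n) = 0\<close> and the
    expression is 1.\<close>
  have mixed: "generic_triple (\<lambda>a b c. 1 - k\<^sup>2 * (sn (zeta n (a, b, c, 0, 0)))\<^sup>2 * (sn (gam n (a, b, c, 0, 0)))\<^sup>2 \<noteq> 0)" for n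
  proof -
    have "regular_at (pt 0) (\<lambda>q. 1 - k\<^sup>2 * (sn (zeta n q))\<^sup>2 * (sn (gam n q))\<^sup>2)"
      by (intro regular_at_intros regular_forms regular_gam)
    moreover have "1 - k\<^sup>2 * (sn (zeta n (pt 0)))\<^sup>2 * (sn (gam n (pt 0)))\<^sup>2 \<noteq> 0"
      by (simp add: forms_at_pt)
    ultimately have "generic_triple (\<lambda>a b c. 1 - k\<^sup>2 * (sn (zeta n (a, b, c, r * 0, r * 0)))\<^sup>2 * (sn (gam n (a, b, c, r * 0, r * 0)))\<^sup>2 \<noteq> 0 \<and>
      generic_pair (\<lambda>x y. 1 - k\<^sup>2 * (sn (zeta n (a, b, c, x, y)))\<^sup>2 * (sn (gam n (a, b, c, x, y)))\<^sup>2 \<noteq> 0))"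
      unfolding pt_def by (rule regular_at_generic_nonzero)
    then show ?thesis by (rule generic_triple_mono) simp
  qed
  have "generic_triple (\<lambda>a b c. \<forall>n. (alpha n (a, b, c, 0, 0) \<notin> - reg \<and> beta n (a, b, c, 0, 0) \<notin> - reg) \<and>
    (zeta n (a, b, c, 0, 0) \<notin> Z \<and> zeta n (a, b, c, 0, 0) + zeta n (a, b, c, 0, 0) \<notin> - reg) \<and>
    gam n (a, b, c, 0, 0) \<notin> - reg \<and> 1 - k\<^sup>2 * (sn (zeta n (a, b, c, 0, 0)))\<^sup>2 * (sn (gam n (a, b, c, 0, 0)))\<^sup>2 \<noteq> 0)"
    by (intro generic_triple_all generic_triple_conj gam mixed
          1[OF countable_not_reg _ affine_forms(1)] 1[OF countable_not_reg _ affine_forms(2)]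
          1[OF Z _ affine_forms(4)] 1[OF countable_not_reg _ affine_forms(5)]) simp_all
  then show ?thesis
    by (rule generic_triple_mono) (auto simp: admissible_def Z_def)
qed

end

lemma generic_parameters:
  "generic_triple (\<lambda>a b c. admissible (a, b, c, 0, 0) \<and> generic_pair (\<lambda>x y. nondegenerate (a, b, c, x, y)))"
proof -
  obtain K where "K \<in> reg" "cn K * dn K = 0" using exists_critical_point[OF modulus] by blast
  then show ?thesis by (intro generic_triple_conj generic_admissible generic_nondegenerate)
qed

end

text \<open>On the quads of the two diagonals the equivalence requires nothing of the initial
  values. Extending a solution of the difference equation to the whole lattice divides by the
  denominators of the other quads, which is why the last clause speaks of generic initial
  pairs.\<close>

theorem proposition4p1:
  fixes k r :: complex and sn cn dn :: "complex \<Rightarrow> complex"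
  assumes "k \<notin> {0, 1, -1}" and "r\<^sup>2 = k"
    and "jacobi_elliptic k sn cn dn"
  shows "generic_triple (\<lambda>\<alpha>\<^sub>0 \<beta>\<^sub>0 \<phi>.
    let sys = constrained_Q4_system k sn \<alpha>\<^sub>0 \<beta>\<^sub>0 \<phi>;
        ell = elliptic_difference_equation k sn cn dn
                ((\<alpha>\<^sub>0 - \<beta>\<^sub>0) / 2) ((\<alpha>\<^sub>0 + \<beta>\<^sub>0) / 2) ((\<phi> - \<alpha>\<^sub>0 - \<beta>\<^sub>0) / 2)
    in generic_pair (\<lambda>x y. \<exists>!v. sys v \<and> v 0 0 = x \<and> v 0 1 = y) \<and>
       (\<forall>v u. sys v \<and> identified r v u \<longrightarrow> ell u) \<and>
       (\<forall>v u. diagonal_constraint v \<and> identified r v u \<longrightarrow>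
          ((\<forall>n. Q4_at k sn \<alpha>\<^sub>0 \<beta>\<^sub>0 \<phi> v n n \<and> Q4_at k sn \<alpha>\<^sub>0 \<beta>\<^sub>0 \<phi> v n (n + 1)) \<longleftrightarrow> ell u)) \<and>
       generic_pair (\<lambda>x y. \<forall>u.
          ell u \<and> u (-1) = x / r \<and> u 0 = y / r \<longleftrightarrow>
          (\<exists>v. sys v \<and> v 0 0 = x \<and> v 0 1 = y \<and> identified r v u)))"
proof -
  interpret diagonal_Q4 k sn cn dn r by unfold_locales (use assms in auto)
  show ?thesis
  proof (rule generic_triple_mono[OF generic_parameters])
    fix a b c
    assume "admissible (a, b, c, 0, 0) \<and> generic_pair (\<lambda>x y. nondegenerate (a, b, c, x, y))"
    then have adm: "admissible (a, b, c, x, y)" and nondeg: "generic_pair (\<lambda>x y. nondegenerate (a, b, c, x, y))" for x y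
      using admissible_cong by blast+
    define sys where "sys = constrained_Q4_system k sn a b c"
    define ell where "ell = elliptic_difference_equation k sn cn dn ((a - b) / 2) ((a + b) / 2) ((c - a - b) / 2)"
    have sys: "sys v \<longleftrightarrow> (\<forall>n m. quad_at (a, b, c, x, y) v n m) \<and> diagonal_constraint v" for v x y
      unfolding sys_def constrained_Q4_system_def Q4_at_iff[of a b c v _ _ x y] ..
    have ell: "ell u \<longleftrightarrow> (\<forall>n. ell_at (a, b, c, x, y) u n)" for u x y
      unfolding ell_def by (rule elliptic_difference_equation_iff)
    have "generic_pair (\<lambda>x y. \<exists>!v. sys v \<and> v 0 0 = x \<and> v 0 1 = y)"
    proof (rule generic_pair_mono[OF nondeg])
      fix x y assume "nondegenerate (a, b, c, x, y)"
      from system_iff[OF adm this]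
      have "sys v \<and> v 0 0 = x \<and> v 0 1 = y \<longleftrightarrow> v = lattice (a, b, c, x, y)" for v
        unfolding sys[of v x y] by (simp add: init_x_def init_y_def)
      then show "\<exists>!v. sys v \<and> v 0 0 = x \<and> v 0 1 = y" by simp
    qed
    moreover have diagonal: "(\<forall>n. Q4_at k sn a b c v n n \<and> Q4_at k sn a b c v n (n + 1)) \<longleftrightarrow> ell u"
      if "diagonal_constraint v" "identified r v u" for v u
      unfolding Q4_at_iff[of a b c v _ _ 0 0] ell[of u 0 0] by (rule diagonal_quads_iff[OF adm that])
    moreover have "ell u" if "sys v" "identified r v u" for v u
      using diagonal[OF _ that(2)] that(1) unfolding sys_def constrained_Q4_system_def by blast
    moreover have "generic_pair (\<lambda>x y. \<forall>u. ell u \<and> u (- 1) = x / r \<and> u 0 = y / r \<longleftrightarrow>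
          (\<exists>v. sys v \<and> v 0 0 = x \<and> v 0 1 = y \<and> identified r v u))"
    proof (rule generic_pair_mono[OF nondeg], rule allI)
      fix x y u assume "nondegenerate (a, b, c, x, y)"
      from diag_iff[OF adm this]
      show "ell u \<and> u (- 1) = x / r \<and> u 0 = y / r \<longleftrightarrow> (\<exists>v. sys v \<and> v 0 0 = x \<and> v 0 1 = y \<and> identified r v u)"
        unfolding sys[of _ x y] ell[of u x y] by (simp add: init_x_def init_y_def)
    qed
    ultimately show "let sys = constrained_Q4_system k sn a b c;
        ell = elliptic_difference_equation k sn cn dn ((a - b) / 2) ((a + b) / 2) ((c - a - b) / 2)
    in generic_pair (\<lambda>x y. \<exists>!v. sys v \<and> v 0 0 = x \<and> v 0 1 = y) \<and>
       (\<forall>v u. sys v \<and> identified r v u \<longrightarrow> ell u) \<and>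
       (\<forall>v u. diagonal_constraint v \<and> identified r v u \<longrightarrow>
          ((\<forall>n. Q4_at k sn a b c v n n \<and> Q4_at k sn a b c v n (n + 1)) \<longleftrightarrow> ell u)) \<and>
       generic_pair (\<lambda>x y. \<forall>u.
          ell u \<and> u (-1) = x / r \<and> u 0 = y / r \<longleftrightarrow>
          (\<exists>v. sys v \<and> v 0 0 = x \<and> v 0 1 = y \<and> identified r v u))"
      unfolding Let_def sys_def[symmetric] ell_def[symmetric] by blast
  qed
qed

end
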